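(* Let $\Lambda$ be a discretely ordered abelian group, $X$ a set, and $G$ a subgroup of $CDR(\Lambda,X)$, with its $\Lambda$-tree $\Gamma_G$, base point $\epsilon=\langle 0,1\rangle$ and action of $G$ on $\Gamma_G$. If $(Z,d')$ is a $\Lambda$-tree on which $G$ acts freely as isometries, and $w\in Z$ is such that $L_w(g)=|g|$ for all $g\in G$, where $L_w(g)=d'(w,g\cdot w)$, then there is a unique $G$-equivariant isometry $\mu:\Gamma_G\to Z$ such that $\mu(\epsilon)=w$, and its image is the subtree of $Z$ spanned by the orbit $G\cdot w$ of $w$.
   Context: $\Lambda$ is a (linearly) ordered abelian group, discretely ordered: it has a minimal positive element, denoted $1$. For $a,b\in\Lambda$, $[a,b]=\{c\in\Lambda\mid a\le c\le b\}$. Infinite words. For a set $X$ put $X^{\pm}=X\cup X^{-1}$ (formal inverses, $(x^{-1})^{-1}=x$). A $\Lambda$-word is a function $w:[1,\alpha_w]\to X^{\pm}$ with $\alpha_w\in\Lambda$, $\alpha_w\ge 0$; $|w|=\alpha_w$ is its length; $\varepsilon$ is the empty word. The concatenation $uv$ has length $|u|+|v|$, with $(uv)(a)=u(a)$ for $1\le a\le|u|$ and $(uv)(a)=v(a-|u|)$ for $|u|<a\le|u|+|v|$. The inverse $w^{-1}$ has length $|w|$ and $w^{-1}(\beta)=w(|w|+1-\beta)^{-1}$. The word $w$ is reduced if $w(\beta+1)\ne w(\beta)^{-1}$ for all $1\le\beta<|w|$; $R(\Lambda,X)$ is the set of reduced $\Lambda$-words. Write $uv=u\circ v$ if $u,v$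 and $uv$ are reduced. For $u,v\in R(\Lambda,X)$, $\mathrm{com}(u,v)$ is the longest common initial segment of $u$ and $v$, if it exists: $u=\mathrm{com}(u,v)\circ\tilde u$, $v=\mathrm{com}(u,v)\circ\tilde v$, where $\tilde u,\tilde v$ do not begin with the same letter (either may be empty). If $\mathrm{com}(u^{-1},v)$ is defined, with $u^{-1}=\mathrm{com}(u^{-1},v)\circ\tilde u$ and $v=\mathrm{com}(u^{-1},v)\circ\tilde v$, put $u*v=\tilde u^{-1}\circ\tilde v$; this is a partial operation on $R(\Lambda,X)$. A (nonempty) word $v\in R(\Lambda,X)$ is cyclically reduced if $v(1)^{-1}\ne v(|v|)$; $CDR(\Lambda,X)$ is the set of reduced words $v$ admitting a cyclic decomposition $v=c^{-1}\circ u\circ c$ with $c,u\in R(\Lambda,X)$ and $u$ cyclically reduced, together with the empty word. A subgroup $G$ of $CDR(\Lambda,X)$ is a subset containing $\varepsilon$ (the identity $1$ of $G$), closed under inversion, on which $*$ is everywhere defined with values in $G$ and which is a group under $*$. For $f,g\in G$ the word $\mathrm{com}(f,g)$ is then defined, and $c(f,g)=\frac12(|f|+|g|-|f^{-1}*g|)=|\mathrm{com}(f,g)|\in\Lambda$. $\Lambda$-trees. A $\Lambda$-metric space is a nonempty set with a $\Lambda$-valued metric (usual axioms). An isometry between $\Lambda$-metric spaces is a distance-preserving map (not assumed surjective). A segment is the image of an isometry from some $[a,b]\subset\Lambda$ (metric $|x-y|$), with endpoints the images of $a$ and $b$. A $\Lambda$-tree is a $\Lambda$-metric space such that (T1) any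 two points are the endpoints of some segment; (T2) if two segments intersect in a single point which is an endpoint of both, their union is a segment; (T3) the intersection of two segments with a common endpoint is a segment. A subtree is a subset containing, with any two of its points, the segment joining them; the subtree spanned by a set is the smallest subtree containing it. An action by isometries is free if every nontrivial element is hyperbolic, i.e. neither it nor its square has a fixed point. The tree $\Gamma_G$. $S_G=\{(\alpha,g)\mid g\in G,\ \alpha\in[0,|g|]\}$, $(\alpha,f)\sim(\beta,g)\iff\alpha=\beta\in[0,c(f,g)]$, $\Gamma_G=S_G/\sim$, $\langle\alpha,f\rangle$ is the class of $(\alpha,f)$, and $d(\langle \alpha, f \rangle, \langle \beta, g \rangle) = \alpha + \beta - 2\min\{\alpha, \beta, c(f,g)\}$; this is a $\Lambda$-tree. $G$ acts on $\Gamma_G$ by isometries via $f\cdot\langle\alpha,g\rangle=\langle|f|-\alpha,f\rangle$ if $\alpha\le c(f^{-1},g)$, and $f\cdot\langle\alpha,g\rangle=\langle|f|+\alpha-2c(f^{-1},g),f*g\rangle$ if $\alpha>c(f^{-1},g)$. *)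

theory Defs
  imports "HOL-Algebra.Group_Action" "HOL.Hull"
begin

section \<open>Discretely ordered abelian groups\<close>

text \<open>
  The absolute value is determined by the order; it is part of the class only so that the metric
  of \<open>\<Lambda>\<close> can be written \<open>\<bar>x - y\<bar>\<close>. No multiplication is assumed, so twice \<open>x\<close> is \<open>x + x\<close>.
\<close>

class discretely_ordered_ab_group_add =
  linordered_ab_group_add + ordered_ab_group_add_abs + one +
  assumes one_pos: "0 < 1"
    and one_least_pos: "0 < a \<Longrightarrow> 1 \<le> a"

instance int :: discretely_ordered_ab_group_add
  by standard auto


section \<open>Infinite words\<close>

datatype 'x letter = Pos 'x | Neg 'x

fun linv :: "'x letter \<Rightarrow> 'x letter" where
  "linv (Pos x) = Neg x"
| "linv (Neg x) = Pos x"

definition letters :: "'x set \<Rightarrow> 'x letter set" where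
  "letters X = Pos ` X \<union> Neg ` X"

text \<open>
  A word is its length together with a function on \<open>{1..length}\<close>, made extensional so that equality
  of pairs is equality of words.
\<close>

type_synonym ('l, 'x) lword = "'l \<times> ('l \<Rightarrow> 'x letter)"

abbreviation wlen :: "('l, 'x) lword \<Rightarrow> 'l" where
  "wlen w \<equiv> fst w"

abbreviation wat :: "('l, 'x) lword \<Rightarrow> 'l \<Rightarrow> 'x letter" where
  "wat w \<equiv> snd w"

definition is_word :: "('l::discretely_ordered_ab_group_add, 'x) lword \<Rightarrow> bool" where
  "is_word w \<longleftrightarrow> 0 \<le> wlen w \<and> wat w \<in> extensional {1..wlen w}"

definition wempty :: "('l::discretely_ordered_ab_group_add, 'x) lword" where
  "wempty = (0, \<lambda>_. undefined)"

definition wconcat ::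
  "('l::discretely_ordered_ab_group_add, 'x) lword \<Rightarrow> ('l, 'x) lword \<Rightarrow> ('l, 'x) lword" where
  "wconcat u v =
     (wlen u + wlen v,
      \<lambda>a\<in>{1..wlen u + wlen v}. if a \<le> wlen u then wat u a else wat v (a - wlen u))"

definition winv :: "('l::discretely_ordered_ab_group_add, 'x) lword \<Rightarrow> ('l, 'x) lword" where
  "winv w = (wlen w, \<lambda>b\<in>{1..wlen w}. linv (wat w (wlen w + 1 - b)))"

definition reduced_word :: "('l::discretely_ordered_ab_group_add, 'x) lword \<Rightarrow> bool" where
  "reduced_word w \<longleftrightarrow>
     is_word w \<and> (\<forall>b. 1 \<le> b \<and> b < wlen w \<longrightarrow> wat w (b + 1) \<noteq> linv (wat w b))"

definition R_words :: "'x set \<Rightarrow> ('l::discretely_ordered_ab_group_add, 'x) lword set" where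
  "R_words X = {w. reduced_word w \<and> wat w ` {1..wlen w} \<subseteq> letters X}"

text \<open>\<open>is_circ w u v\<close> is \<open>w = u \<circ> v\<close>.\<close>

definition is_circ ::
  "('l::discretely_ordered_ab_group_add, 'x) lword \<Rightarrow> ('l, 'x) lword \<Rightarrow> ('l, 'x) lword \<Rightarrow> bool"
where
  "is_circ w u v \<longleftrightarrow> reduced_word u \<and> reduced_word v \<and> reduced_word w \<and> w = wconcat u v"

text \<open>
  \<open>com_split u v c p q\<close> says that \<open>c = com(u, v)\<close>, \<open>u = c \<circ> p\<close> and \<open>v = c \<circ> q\<close>. No alphabet is
  mentioned: if \<open>u\<close> and \<open>v\<close> are words over \<open>X\<close>, then so are \<open>c\<close>, \<open>p\<close> and \<open>q\<close>.
\<close>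

definition com_split ::
  "('l::discretely_ordered_ab_group_add, 'x) lword \<Rightarrow> ('l, 'x) lword \<Rightarrow>
   ('l, 'x) lword \<Rightarrow> ('l, 'x) lword \<Rightarrow> ('l, 'x) lword \<Rightarrow> bool"
where
  "com_split u v c p q \<longleftrightarrow>
     is_circ u c p \<and> is_circ v c q \<and> \<not> (p \<noteq> wempty \<and> q \<noteq> wempty \<and> wat p 1 = wat q 1)"

definition com_defined ::
  "('l::discretely_ordered_ab_group_add, 'x) lword \<Rightarrow> ('l, 'x) lword \<Rightarrow> bool" where
  "com_defined u v \<longleftrightarrow> (\<exists>c p q. com_split u v c p q)"

definition com ::
  "('l::discretely_ordered_ab_group_add, 'x) lword \<Rightarrow> ('l, 'x) lword \<Rightarrow> ('l, 'x) lword" where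
  "com u v = (THE c. \<exists>p q. com_split u v c p q)"

text \<open>\<open>star u v\<close> is meaningful only if \<open>com_defined (winv u) v\<close>.\<close>

definition star ::
  "('l::discretely_ordered_ab_group_add, 'x) lword \<Rightarrow> ('l, 'x) lword \<Rightarrow> ('l, 'x) lword" where
  "star u v = (THE w. \<exists>c p q. com_split (winv u) v c p q \<and> is_circ w (winv p) q)"

definition cyclically_reduced :: "('l::discretely_ordered_ab_group_add, 'x) lword \<Rightarrow> bool" where
  "cyclically_reduced v \<longleftrightarrow>
     reduced_word v \<and> v \<noteq> wempty \<and> linv (wat v 1) \<noteq> wat v (wlen v)"

definition CDR :: "'x set \<Rightarrow> ('l::discretely_ordered_ab_group_add, 'x) lword set" where
  "CDR X = insert wempty
     {v \<in> R_words X. \<exists>c\<in>R_words X. \<exists>u\<in>R_words X. cyclically_reduced u \<and>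
        is_circ (wconcat (winv c) u) (winv c) u \<and> is_circ v (wconcat (winv c) u) c}"

definition word_group ::
  "('l::discretely_ordered_ab_group_add, 'x) lword set \<Rightarrow> ('l, 'x) lword monoid" where
  "word_group G = \<lparr>carrier = G, mult = star, one = wempty\<rparr>"

definition CDR_subgroup ::
  "'x set \<Rightarrow> ('l::discretely_ordered_ab_group_add, 'x) lword set \<Rightarrow> bool" where
  "CDR_subgroup X G \<longleftrightarrow>
     G \<subseteq> CDR X \<and> wempty \<in> G \<and> (\<forall>g\<in>G. winv g \<in> G) \<and>
     (\<forall>f\<in>G. \<forall>g\<in>G. com_defined (winv f) g \<and> star f g \<in> G) \<and>
     group (word_group G)"

text \<open>Lemma \<open>cprod_double\<close> below shows that this is half of \<open>|f| + |g| - |f\<^sup>-\<^sup>1 * g|\<close>.\<close>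

definition cprod ::
  "('l::discretely_ordered_ab_group_add, 'x) lword \<Rightarrow> ('l, 'x) lword \<Rightarrow> 'l" where
  "cprod f g = wlen (com f g)"


section \<open>\<open>\<Lambda>\<close>-trees\<close>

definition lambda_metric ::
  "'z set \<Rightarrow> ('z \<Rightarrow> 'z \<Rightarrow> 'l::discretely_ordered_ab_group_add) \<Rightarrow> bool" where
  "lambda_metric M d \<longleftrightarrow>
     M \<noteq> {} \<and>
     (\<forall>x\<in>M. \<forall>y\<in>M. 0 \<le> d x y \<and> (d x y = 0 \<longleftrightarrow> x = y) \<and> d x y = d y x) \<and>
     (\<forall>x\<in>M. \<forall>y\<in>M. \<forall>z\<in>M. d x z \<le> d x y + d y z)"

definition isometry_between ::
  "'a set \<Rightarrow> ('a \<Rightarrow> 'a \<Rightarrow> 'l) \<Rightarrow> 'b set \<Rightarrow> ('b \<Rightarrow> 'b \<Rightarrow> 'l) \<Rightarrow> ('a \<Rightarrow> 'b) \<Rightarrow> bool" where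
  "isometry_between M d N d' f \<longleftrightarrow>
     f \<in> M \<rightarrow> N \<and> (\<forall>x\<in>M. \<forall>y\<in>M. d' (f x) (f y) = d x y)"

definition segment_between ::
  "'z set \<Rightarrow> ('z \<Rightarrow> 'z \<Rightarrow> 'l::discretely_ordered_ab_group_add) \<Rightarrow> 'z \<Rightarrow> 'z \<Rightarrow> 'z set \<Rightarrow> bool"
where
  "segment_between M d x y S \<longleftrightarrow>
     (\<exists>a b f. a \<le> b \<and> isometry_between {a..b} (\<lambda>s t. \<bar>s - t\<bar>) M d f \<and>
        S = f ` {a..b} \<and> x = f a \<and> y = f b)"

definition is_segment ::
  "'z set \<Rightarrow> ('z \<Rightarrow> 'z \<Rightarrow> 'l::discretely_ordered_ab_group_add) \<Rightarrow> 'z set \<Rightarrow> bool" where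
  "is_segment M d S \<longleftrightarrow> (\<exists>x y. segment_between M d x y S)"

definition lambda_tree ::
  "'z set \<Rightarrow> ('z \<Rightarrow> 'z \<Rightarrow> 'l::discretely_ordered_ab_group_add) \<Rightarrow> bool" where
  "lambda_tree M d \<longleftrightarrow>
     lambda_metric M d \<and>
     (\<forall>x\<in>M. \<forall>y\<in>M. \<exists>S. segment_between M d x y S) \<and>
     (\<forall>p x y S T. segment_between M d p x S \<and> segment_between M d p y T \<and> S \<inter> T = {p}
        \<longrightarrow> is_segment M d (S \<union> T)) \<and>
     (\<forall>p x y S T. segment_between M d p x S \<and> segment_between M d p y T
        \<longrightarrow> is_segment M d (S \<inter> T))"

definition is_subtree ::
  "'z set \<Rightarrow> ('z \<Rightarrow> 'z \<Rightarrow> 'l::discretely_ordered_ab_group_add) \<Rightarrow> 'z set \<Rightarrow> bool" where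
  "is_subtree M d Y \<longleftrightarrow>
     Y \<subseteq> M \<and> (\<forall>x\<in>Y. \<forall>y\<in>Y. \<forall>S. segment_between M d x y S \<longrightarrow> S \<subseteq> Y)"

definition spanned_subtree ::
  "'z set \<Rightarrow> ('z \<Rightarrow> 'z \<Rightarrow> 'l::discretely_ordered_ab_group_add) \<Rightarrow> 'z set \<Rightarrow> 'z set" where
  "spanned_subtree M d A = (is_subtree M d) hull A"

definition isometric_action ::
  "('g, 'b) monoid_scheme \<Rightarrow> 'z set \<Rightarrow> ('z \<Rightarrow> 'z \<Rightarrow> 'l) \<Rightarrow> ('g \<Rightarrow> 'z \<Rightarrow> 'z) \<Rightarrow> bool" where
  "isometric_action G M d \<phi> \<longleftrightarrow>
     group_action G M \<phi> \<and> (\<forall>g\<in>carrier G. isometry_between M d M d (\<phi> g))"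

definition hyperbolic :: "'z set \<Rightarrow> ('z \<Rightarrow> 'z) \<Rightarrow> bool" where
  "hyperbolic M h \<longleftrightarrow> (\<forall>z\<in>M. h z \<noteq> z \<and> h (h z) \<noteq> z)"

definition free_action ::
  "('g, 'b) monoid_scheme \<Rightarrow> 'z set \<Rightarrow> ('g \<Rightarrow> 'z \<Rightarrow> 'z) \<Rightarrow> bool" where
  "free_action G M \<phi> \<longleftrightarrow> (\<forall>g\<in>carrier G. g \<noteq> \<one>\<^bsub>G\<^esub> \<longrightarrow> hyperbolic M (\<phi> g))"


section \<open>The tree of a group of words\<close>

definition SG ::
  "('l::discretely_ordered_ab_group_add, 'x) lword set \<Rightarrow> ('l \<times> ('l, 'x) lword) set" where
  "SG G = {(\<alpha>, g). g \<in> G \<and> \<alpha> \<in> {0..wlen g}}"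

definition SG_rel ::
  "('l::discretely_ordered_ab_group_add, 'x) lword set \<Rightarrow>
   (('l \<times> ('l, 'x) lword) \<times> ('l \<times> ('l, 'x) lword)) set" where
  "SG_rel G = {((\<alpha>, f), (\<beta>, g)).
     (\<alpha>, f) \<in> SG G \<and> (\<beta>, g) \<in> SG G \<and> \<alpha> = \<beta> \<and> \<alpha> \<in> {0..cprod f g}}"

type_synonym ('l, 'x) gpoint = "('l \<times> ('l, 'x) lword) set"

definition gclass ::
  "('l::discretely_ordered_ab_group_add, 'x) lword set \<Rightarrow> 'l \<Rightarrow> ('l, 'x) lword \<Rightarrow> ('l, 'x) gpoint"
where
  "gclass G \<alpha> g = SG_rel G `` {(\<alpha>, g)}"

definition Gamma ::
  "('l::discretely_ordered_ab_group_add, 'x) lword set \<Rightarrow> ('l, 'x) gpoint set" where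
  "Gamma G = SG G // SG_rel G"

definition gbase ::
  "('l::discretely_ordered_ab_group_add, 'x) lword set \<Rightarrow> ('l, 'x) gpoint" where
  "gbase G = gclass G 0 wempty"

text \<open>
  The distance and the action are given on representatives; \<open>the_elem\<close> extracts the common value
  over all representatives.
\<close>

definition gdist ::
  "('l::discretely_ordered_ab_group_add, 'x) gpoint \<Rightarrow> ('l, 'x) gpoint \<Rightarrow> 'l" where
  "gdist P Q = the_elem
     ((\<lambda>((\<alpha>, f), (\<beta>, g)).
         let m = min \<alpha> (min \<beta> (cprod f g)) in \<alpha> + \<beta> - (m + m)) ` (P \<times> Q))"

definition gact ::
  "('l::discretely_ordered_ab_group_add, 'x) lword set \<Rightarrow> ('l, 'x) lword \<Rightarrow>
   ('l, 'x) gpoint \<Rightarrow> ('l, 'x) gpoint" where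
  "gact G f P = the_elem
     ((\<lambda>(\<alpha>, g).
         let c = cprod (winv f) g in
         if \<alpha> \<le> c then gclass G (wlen f - \<alpha>) f
         else gclass G (wlen f + \<alpha> - (c + c)) (star f g)) ` P)"

text \<open>Extensionality is required so that uniqueness is uniqueness as a map on \<open>\<Gamma>\<^sub>G\<close>.\<close>

definition based_equivariant_isometry ::
  "('l::discretely_ordered_ab_group_add, 'x) lword set \<Rightarrow> 'z set \<Rightarrow> ('z \<Rightarrow> 'z \<Rightarrow> 'l) \<Rightarrow>
   (('l, 'x) lword \<Rightarrow> 'z \<Rightarrow> 'z) \<Rightarrow> 'z \<Rightarrow> (('l, 'x) gpoint \<Rightarrow> 'z) \<Rightarrow> bool"
where
  "based_equivariant_isometry G Z d' \<phi> w \<mu> \<longleftrightarrow>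
     \<mu> \<in> extensional (Gamma G) \<and>
     isometry_between (Gamma G) gdist Z d' \<mu> \<and>
     (\<forall>g\<in>G. \<forall>P\<in>Gamma G. \<mu> (gact G g P) = \<phi> g (\<mu> P)) \<and>
     \<mu> (gbase G) = w"


section \<open>Uniqueness of \<open>com\<close> and of the product\<close>

lemma is_circD:
  assumes "is_circ w u v"
  shows "0 \<le> wlen u" "0 \<le> wlen v" "wlen w = wlen u + wlen v"
    "\<And>a. 1 \<le> a \<Longrightarrow> a \<le> wlen u \<Longrightarrow> wat w a = wat u a"
    "\<And>a. 1 \<le> a \<Longrightarrow> a \<le> wlen v \<Longrightarrow> wat w (wlen u + a) = wat v a"
proof -
  show u: "0 \<le> wlen u" and v: "0 \<le> wlen v" and "wlen w = wlen u + wlen v"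
    using assms by (auto simp: is_circ_def reduced_word_def is_word_def wconcat_def)
  show "wat w a = wat u a" if "1 \<le> a" "a \<le> wlen u" for a
    using assms that v order_trans[of a "wlen u" "wlen u + wlen v"]
    by (auto simp: is_circ_def wconcat_def)
  show "wat w (wlen u + a) = wat v a" if a: "1 \<le> a" "a \<le> wlen v" for a
  proof -
    have "0 < a" using a(1) one_pos less_le_trans by blast
    then have "\<not> wlen u + a \<le> wlen u" by simp
    moreover have "1 \<le> wlen u + a" using u a(1) add_mono[of 0 "wlen u" 1 a] by simp
    ultimately show ?thesis using assms a by (auto simp: is_circ_def wconcat_def)
  qed
qed

lemma word_eqI:
  assumes "is_word u" "is_word v" "wlen u = wlen v"
    "\<And>a. 1 \<le> a \<Longrightarrow> a \<le> wlen u \<Longrightarrow> wat u a = wat v a"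
  shows "u = v"
proof (rule prod_eqI)
  show "wat u = wat v"
    by (rule extensionalityI[of _ "{1..wlen u}"]) (use assms in \<open>auto simp: is_word_def\<close>)
qed (use assms in auto)

lemma com_split_len_le:
  assumes 1: "com_split u v c p q" and 2: "com_split u v c' p' q'"
  shows "wlen c' \<le> wlen c"
proof (rule ccontr)
  assume "\<not> wlen c' \<le> wlen c"
  then have lt: "wlen c < wlen c'" by simp
  note up = is_circD[of u c p] and vq = is_circD[of v c q]
    and up' = is_circD[of u c' p'] and vq' = is_circD[of v c' q']
  have circ: "is_circ u c p" "is_circ v c q" "is_circ u c' p'" "is_circ v c' q'"
    using 1 2 by (auto simp: com_split_def)
  have "wlen c + 1 \<le> wlen c'"
    using one_least_pos[of "wlen c' - wlen c"] lt by (simp add: algebra_simps)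
  moreover have "1 \<le> wlen c + 1" using up(1)[OF circ(1)] by simp
  ultimately have "wat u (wlen c + 1) = wat v (wlen c + 1)"
    using up'(4)[OF circ(3)] vq'(4)[OF circ(4)] by simp
  moreover have pos: "0 < wlen p" "0 < wlen q"
  proof -
    have "wlen c < wlen c + wlen p"
      using lt up(3)[OF circ(1)] up'(3)[OF circ(3)] up'(2)[OF circ(3)]
      by (metis add_increasing2 less_le_trans order_refl)
    then show "0 < wlen p" by simp
    have "wlen c < wlen c + wlen q"
      using lt vq(3)[OF circ(2)] vq'(3)[OF circ(4)] vq'(2)[OF circ(4)]
      by (metis add_increasing2 less_le_trans order_refl)
    then show "0 < wlen q" by simp
  qed
  ultimately have "wat p 1 = wat q 1"
    using up(5)[OF circ(1), of 1] vq(5)[OF circ(2), of 1]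
      one_least_pos[OF pos(1)] one_least_pos[OF pos(2)] by simp
  moreover have "p \<noteq> wempty" "q \<noteq> wempty" using pos by (auto simp: wempty_def)
  ultimately show False using 1 by (auto simp: com_split_def)
qed

lemma com_split_unique:
  assumes 1: "com_split u v c p q" and 2: "com_split u v c' p' q'"
  shows "c = c' \<and> p = p' \<and> q = q'"
proof -
  have len: "wlen c = wlen c'"
    using com_split_len_le[OF 1 2] com_split_len_le[OF 2 1] by simp
  have circ: "is_circ u c p" "is_circ v c q" "is_circ u c' p'" "is_circ v c' q'"
    using 1 2 by (auto simp: com_split_def)
  then have w: "is_word c" "is_word p" "is_word q" "is_word c'" "is_word p'" "is_word q'"
    by (auto simp: is_circ_def reduced_word_def)
  have "c = c'"
    using is_circD(4)[OF circ(1)] is_circD(4)[OF circ(3)] len by (intro word_eqI w) auto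
  moreover have "p = p'"
  proof (rule word_eqI)
    show len_p: "wlen p = wlen p'"
      using is_circD(3)[OF circ(1)] is_circD(3)[OF circ(3)] len by simp
    show "wat p a = wat p' a" if "1 \<le> a" "a \<le> wlen p" for a
      using is_circD(5)[OF circ(1) that] is_circD(5)[OF circ(3), of a] that len len_p by simp
  qed (use w in auto)
  moreover have "q = q'"
  proof (rule word_eqI)
    show len_q: "wlen q = wlen q'"
      using is_circD(3)[OF circ(2)] is_circD(3)[OF circ(4)] len by simp
    show "wat q a = wat q' a" if "1 \<le> a" "a \<le> wlen q" for a
      using is_circD(5)[OF circ(2) that] is_circD(5)[OF circ(4), of a] that len len_q by simp
  qed (use w in auto)
  ultimately show ?thesis by simp
qed

lemma com_eqI: "com_split u v c p q \<Longrightarrow> com u v = c"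
  unfolding com_def by (rule the_equality) (blast dest: com_split_unique)+

lemma star_eqI:
  assumes "com_split (winv u) v c p q" "is_circ w (winv p) q"
  shows "star u v = w"
  unfolding star_def
proof (rule the_equality)
  fix w' assume "\<exists>c p q. com_split (winv u) v c p q \<and> is_circ w' (winv p) q"
  then obtain c' p' q' where *: "com_split (winv u) v c' p' q'" "is_circ w' (winv p') q'"
    by blast
  with com_split_unique[OF assms(1)] have "p' = p" "q' = q" by auto
  with *(2) assms(2) show "w' = w" by (simp add: is_circ_def)
qed (use assms in blast)

lemma linv_linv [simp]: "linv (linv x) = x"
  by (cases x) auto

lemma wlen_winv [simp]: "wlen (winv w) = wlen w"
  by (simp add: winv_def)

lemma wat_winv:
  assumes "1 \<le> b" "b \<le> wlen w"
  shows "wat (winv w) b = linv (wat w (wlen w + 1 - b))"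
  using assms by (simp add: winv_def)

lemma less_add_one_le:
  fixes a b :: "'l::discretely_ordered_ab_group_add"
  shows "a < b \<longleftrightarrow> a + 1 \<le> b"
proof
  assume "a < b"
  then show "a + 1 \<le> b" using one_least_pos[of "b - a"] by (simp add: algebra_simps)
next
  assume "a + 1 \<le> b"
  moreover have "a < a + 1" using one_pos by simp
  ultimately show "a < b" by (rule less_le_trans[rotated])
qed

lemma is_word_winv: "is_word w \<Longrightarrow> is_word (winv w)"
  by (simp add: is_word_def winv_def)

lemma winv_winv: "is_word w \<Longrightarrow> winv (winv w) = w"
proof (rule word_eqI)
  fix a assume "is_word w" and "1 \<le> a" "a \<le> wlen (winv (winv w))"
  then have a: "1 \<le> a" "a \<le> wlen w" by simp_all
  then have "1 \<le> wlen w + 1 - a" "wlen w + 1 - a \<le> wlen w"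
    by (simp_all add: algebra_simps)
  then show "wat (winv (winv w)) a = wat w a" using a by (simp add: wat_winv)
qed (simp_all add: is_word_winv)

lemma reduced_winv:
  assumes "reduced_word w"
  shows "reduced_word (winv w)"
  unfolding reduced_word_def
proof (intro conjI allI impI)
  show "is_word (winv w)" using assms by (simp add: reduced_word_def is_word_winv)
  fix b assume "1 \<le> b \<and> b < wlen (winv w)"
  then have b: "1 \<le> b" "b < wlen w" by simp_all
  define c where "c = wlen w - b"
  have b1: "b + 1 \<le> wlen w" using b(2) by (simp add: less_add_one_le)
  have c: "1 \<le> c" "c < wlen w"
    using b b1 one_pos less_le_trans[OF one_pos b(1)] by (simp_all add: c_def algebra_simps)
  have "1 \<le> b + 1" using less_le_trans[OF one_pos b(1)] by simp
  then have "wat (winv w) (b + 1) = linv (wat w c)"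
    using b1 by (simp add: wat_winv c_def)
  moreover have "wat (winv w) b = linv (wat w (c + 1))"
    using b by (simp add: wat_winv c_def algebra_simps)
  moreover have "wat w (c + 1) \<noteq> linv (wat w c)" using assms c by (simp add: reduced_word_def)
  ultimately show "wat (winv w) (b + 1) \<noteq> linv (wat (winv w) b)"
    by (metis linv_linv)
qed

lemma is_circ_winv:
  assumes p: "reduced_word p" and q: "reduced_word q"
    and pq: "\<not> (p \<noteq> wempty \<and> q \<noteq> wempty \<and> wat p 1 = wat q 1)"
  shows "is_circ (wconcat (winv p) q) (winv p) q"
proof -
  let ?w = "wconcat (winv p) q"
  note rp = reduced_winv[OF p]
  have len: "0 \<le> wlen p" "0 \<le> wlen q" using p q by (auto simp: reduced_word_def is_word_def)
  have w1: "wat ?w a = wat (winv p) a" if "1 \<le> a" "a \<le> wlen p" for a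
    using that len order_trans[of a "wlen p" "wlen p + wlen q"] by (simp add: wconcat_def)
  have w2: "wat ?w a = wat q (a - wlen p)" if "wlen p < a" "a \<le> wlen p + wlen q" for a
  proof -
    have "1 \<le> a" using that(1) len(1) one_least_pos[of a] by (meson le_less_trans)
    moreover have "\<not> a \<le> wlen p" using that(1) by simp
    ultimately show ?thesis using that by (simp add: wconcat_def)
  qed
  have "reduced_word ?w"
    unfolding reduced_word_def
  proof (intro conjI allI impI)
    show "is_word ?w" using len by (simp add: is_word_def wconcat_def)
    fix b assume "1 \<le> b \<and> b < wlen ?w"
    then have b: "1 \<le> b" "b < wlen p + wlen q" by (simp_all add: wconcat_def)
    have b0: "b < b + 1" "b + 1 \<le> wlen p + wlen q" "1 \<le> b + 1"
      using b one_pos less_le_trans[OF one_pos b(1)] by (simp_all add: less_add_one_le[symmetric])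
    consider "b < wlen p" | "b = wlen p" | "wlen p < b" by (meson linorder_cases)
    then show "wat ?w (b + 1) \<noteq> linv (wat ?w b)"
    proof cases
      case 1
      then have "wat ?w b = wat (winv p) b" "wat ?w (b + 1) = wat (winv p) (b + 1)"
        using w1[of b] w1[of "b + 1"] b b0 1 less_imp_le[OF 1] less_add_one_le[of b "wlen p"] by blast+
      then show ?thesis using rp 1 b by (simp add: reduced_word_def)
    next
      case 2
      then have "wat ?w b = linv (wat p 1)" using b by (simp add: w1 wat_winv)
      moreover have "wat ?w (b + 1) = wat q 1" using 2 b0 by (simp add: w2)
      moreover have "p \<noteq> wempty" "q \<noteq> wempty"
        using 2 b less_le_trans[OF one_pos b(1)] by (auto simp: wempty_def)
      ultimately show ?thesis using pq by auto
    next
      case 3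
      have "b - wlen p < wlen q" "1 \<le> b - wlen p"
        using 3 b one_least_pos[of "b - wlen p"] by (simp_all add: algebra_simps)
      moreover have "wat ?w b = wat q (b - wlen p)" using 3 b by (simp add: w2)
      moreover have "wat ?w (b + 1) = wat q (b - wlen p + 1)"
        using w2[OF less_trans[OF 3 b0(1)] b0(2)] by (simp add: algebra_simps)
      ultimately show ?thesis using q by (simp add: reduced_word_def)
    qed
  qed
  then show ?thesis using rp q by (simp add: is_circ_def)
qed

lemma cprod_double:
  assumes "com_defined f g"
  shows "cprod f g + cprod f g = wlen f + wlen g - wlen (star (winv f) g)"
proof -
  obtain c p q where s: "com_split f g c p q" using assms by (auto simp: com_defined_def)
  then have f: "is_circ f c p" and g: "is_circ g c q"
    and pq: "\<not> (p \<noteq> wempty \<and> q \<noteq> wempty \<and> wat p 1 = wat q 1)"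
    by (auto simp: com_split_def)
  have circ: "is_circ (wconcat (winv p) q) (winv p) q"
    using f g pq by (intro is_circ_winv) (auto simp: is_circ_def)
  have "winv (winv f) = f" using f by (intro winv_winv) (auto simp: is_circ_def reduced_word_def)
  with s circ have "star (winv f) g = wconcat (winv p) q" by (intro star_eqI) auto
  then show ?thesis
    using is_circD(3)[OF f] is_circD(3)[OF g] com_eqI[OF s]
    by (simp add: cprod_def wconcat_def algebra_simps)
qed

end

theory Submission
  imports Defs
begin

text \<open>
  In a \<open>\<Lambda>\<close>-tree, two geodesics issuing from a common point agree up to a branch point and then
  separate for good; the distance \<open>k\<close> to the branch point of \<open>[w,x]\<close> and \<open>[w,y]\<close> is given by
  \<open>2k = d(w,x) + d(w,y) - d(x,y)\<close>. For \<open>x = f\<cdot>w\<close> and \<open>y = g\<cdot>w\<close> the hypothesis on \<open>L\<^sub>w\<close> turns this into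
  \<open>k = c(f,g)\<close>. Hence sending \<open>\<langle>\<alpha>,g\<rangle>\<close> to the point of \<open>[w, g\<cdot>w]\<close> at distance \<open>\<alpha>\<close> from \<open>w\<close>
  identifies two pairs exactly when they are equivalent, and it carries the formulas for the distance
  and for the action on \<open>\<Gamma>\<^sub>G\<close> to those of \<open>Z\<close>. In particular these formulas do not depend on
  representatives, with no need to argue about words. The image is the union of the segments
  \<open>[w, g\<cdot>w]\<close>, which is a subtree because a segment \<open>[x,y]\<close> lies in \<open>[w,x] \<union> [w,y]\<close>.
\<close>

section \<open>Reflection of intervals, absolute values and doubling in ordered groups\<close>

lemma image_reflect_atLeastAtMost:
  fixes n :: "'l::linordered_ab_group_add"
  shows "(\<lambda>s. f (n - s)) ` {0..n} = f ` {0..n}"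
proof -
  have "(\<lambda>s. n - s) ` {0..n} = {0..n}"
  proof (intro equalityI subsetI)
    fix x assume "x \<in> {0..n}"
    then have "n - x \<in> {0..n}" "x = n - (n - x)" by simp_all
    then show "x \<in> (\<lambda>s. n - s) ` {0..n}" by (rule rev_image_eqI)
  qed auto
  then show ?thesis by (metis image_image)
qed

text \<open>Used in \<open>geodesics_split\<close> to recognise an endpoint: there \<open>i\<close>
  and \<open>j\<close> are the distances of two points of a geodesic from its start, and the
  conclusion says that one of them is the start.\<close>

lemma add_eq_abs_diff:
  fixes i j :: "'l::{linordered_ab_group_add,ordered_ab_group_add_abs}"
  assumes "0 \<le> i" "0 \<le> j" "i + j = \<bar>i - j\<bar>"
  shows "i = 0 \<or> j = 0"
proof (cases "i \<le> j")
  case True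
  then have "i + j = j - i" using assms by (simp add: abs_of_nonpos)
  then have "i + i = 0" by (simp add: algebra_simps)
  then show ?thesis by simp
next
  case False
  then have "i + j = i - j" using assms by (simp add: abs_of_nonneg)
  then have "j + j = 0" by (simp add: algebra_simps)
  then show ?thesis by simp
qed

text \<open>Stands in for division by two, which \<Lambda> need not allow: branch points are known
  only through \<open>k + k\<close>, and strict monotonicity of addition recovers
  \<open>k\<close>.\<close>

lemma double_eq_iff: "(a::'l::linordered_ab_group_add) + a = b + b \<longleftrightarrow> a = b"
  by (metis add_strict_mono linorder_neqE order_less_irrefl)

section \<open>Normalised geodesics in a \<Lambda>-tree\<close>

locale lambda_tree_space =
  fixes M :: "'z set" and d :: "'z \<Rightarrow> 'z \<Rightarrow> 'l::discretely_ordered_ab_group_add"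
  assumes lambda_tree: "lambda_tree M d"
begin

text \<open>Parametrised from \<open>0\<close>, so that the parameter of a point is its distance
  from the start \<open>f 0\<close>.\<close>

definition geodesic :: "('l \<Rightarrow> 'z) \<Rightarrow> 'l \<Rightarrow> bool" where
  "geodesic f n \<longleftrightarrow>
     0 \<le> n \<and> f ` {0..n} \<subseteq> M \<and> (\<forall>s\<in>{0..n}. \<forall>t\<in>{0..n}. d (f s) (f t) = \<bar>s - t\<bar>)"

lemma dist_eq_0_iff: "x \<in> M \<Longrightarrow> y \<in> M \<Longrightarrow> d x y = 0 \<longleftrightarrow> x = y"
  and dist_nonneg: "x \<in> M \<Longrightarrow> y \<in> M \<Longrightarrow> 0 \<le> d x y"
  and dist_commute: "x \<in> M \<Longrightarrow> y \<in> M \<Longrightarrow> d x y = d y x"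
  and dist_triangle: "x \<in> M \<Longrightarrow> y \<in> M \<Longrightarrow> z \<in> M \<Longrightarrow> d x z \<le> d x y + d y z"
  using lambda_tree unfolding lambda_tree_def lambda_metric_def by blast+

lemma geodesic_len: "geodesic f n \<Longrightarrow> 0 \<le> n"
  by (simp add: geodesic_def)

lemma geodesic_in: "geodesic f n \<Longrightarrow> 0 \<le> s \<Longrightarrow> s \<le> n \<Longrightarrow> f s \<in> M"
  by (auto simp: geodesic_def)

lemma geodesic_dist_abs:
  "geodesic f n \<Longrightarrow> 0 \<le> s \<Longrightarrow> s \<le> n \<Longrightarrow> 0 \<le> t \<Longrightarrow> t \<le> n \<Longrightarrow> d (f s) (f t) = \<bar>s - t\<bar>"
  by (simp add: geodesic_def)

lemma geodesic_dist:
  assumes "geodesic f n" "0 \<le> s" "s \<le> t" "t \<le> n"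
  shows "d (f s) (f t) = t - s"
proof -
  have "0 \<le> t" "s \<le> n" using assms by (meson order_trans)+
  then have "d (f s) (f t) = \<bar>s - t\<bar>" using assms by (intro geodesic_dist_abs) simp_all
  then show ?thesis using assms by (simp add: abs_of_nonpos)
qed

lemma geodesic_dist_start:
  assumes "geodesic f n" "0 \<le> s" "s \<le> n"
  shows "d (f 0) (f s) = s"
  using geodesic_dist[OF assms(1) order_refl assms(2,3)] by simp

lemma geodesicI:
  assumes "0 \<le> n" "\<And>s. 0 \<le> s \<Longrightarrow> s \<le> n \<Longrightarrow> f s \<in> M"
    and "\<And>s t. 0 \<le> s \<Longrightarrow> s \<le> t \<Longrightarrow> t \<le> n \<Longrightarrow> d (f s) (f t) = t - s"
  shows "geodesic f n"
  unfolding geodesic_def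
proof (intro conjI ballI)
  show "0 \<le> n" by fact
  show "f ` {0..n} \<subseteq> M" using assms(2) by auto
  fix s t assume st: "s \<in> {0..n}" "t \<in> {0..n}"
  then have "d (f s) (f t) = d (f t) (f s)" using assms(2) by (intro dist_commute) auto
  then show "d (f s) (f t) = \<bar>s - t\<bar>"
    using st assms(3)[of s t] assms(3)[of t s] linear[of s t]
    by (auto simp: abs_of_nonpos abs_of_nonneg)
qed

lemma geodesic_shift:
  assumes "geodesic f n" "0 \<le> a" "a \<le> b" "b \<le> n"
  shows "geodesic (\<lambda>s. f (a + s)) (b - a)"
proof (rule geodesicI)
  show "0 \<le> b - a" using assms by simp
  fix s assume "0 \<le> s" "s \<le> b - a"
  then have "a + s \<le> b" by (simp add: algebra_simps)
  then show "f (a + s) \<in> M"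
    using assms \<open>0 \<le> s\<close> by (intro geodesic_in[OF assms(1)]) (auto intro: order_trans)
next
  fix s t assume "0 \<le> s" "s \<le> t" "t \<le> b - a"
  then have "a + t \<le> b" by (simp add: algebra_simps)
  then have "d (f (a + s)) (f (a + t)) = (a + t) - (a + s)"
    using assms \<open>0 \<le> s\<close> \<open>s \<le> t\<close> by (intro geodesic_dist[OF assms(1)]) (auto intro: order_trans)
  then show "d (f (a + s)) (f (a + t)) = t - s" by simp
qed

lemma geodesic_init:
  assumes "geodesic f n" "0 \<le> b" "b \<le> n"
  shows "geodesic f b"
  using geodesic_shift[OF assms(1) order_refl assms(2,3)] by simp

lemma geodesic_rev:
  assumes "geodesic f n"
  shows "geodesic (\<lambda>s. f (n - s)) n"
proof (rule geodesicI)
  show "0 \<le> n" using assms by (rule geodesic_len)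
  show "f (n - s) \<in> M" if "0 \<le> s" "s \<le> n" for s
    using that by (intro geodesic_in[OF assms]) auto
  fix s t assume st: "0 \<le> s" "s \<le> t" "t \<le> n"
  then have m: "0 \<le> n - t" "n - t \<le> n - s" "n - s \<le> n" by auto
  then have "d (f (n - s)) (f (n - t)) = d (f (n - t)) (f (n - s))"
    by (intro dist_commute geodesic_in[OF assms]) (auto intro: order_trans)
  also have "\<dots> = (n - s) - (n - t)" using m by (rule geodesic_dist[OF assms])
  finally show "d (f (n - s)) (f (n - t)) = t - s" by (simp add: algebra_simps)
qed

text \<open>Translating \<open>{a..b}\<close> to \<open>{0..b - a}\<close> normalises any
  parametrisation of a segment.\<close>

lemma segment_between_iff:
  "segment_between M d x y S \<longleftrightarrow>
     (\<exists>f n. geodesic f n \<and> f 0 = x \<and> f n = y \<and> S = f ` {0..n})"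
proof
  assume "segment_between M d x y S"
  then obtain a b f where ab: "a \<le> b"
    and iso: "isometry_between {a..b} (\<lambda>s t. \<bar>s - t\<bar>) M d f"
    and S: "S = f ` {a..b}" and xy: "x = f a" "y = f b"
    unfolding segment_between_def by blast
  have geo: "geodesic (\<lambda>s. f (a + s)) (b - a)"
  proof (rule geodesicI)
    show "0 \<le> b - a" using ab by simp
    show "f (a + s) \<in> M" if "0 \<le> s" "s \<le> b - a" for s
      using iso that by (auto simp: isometry_between_def algebra_simps)
    fix s t assume st: "0 \<le> s" "s \<le> t" "t \<le> b - a"
    then have "0 \<le> t" "s \<le> b - a" by (meson order_trans)+
    with st have "d (f (a + s)) (f (a + t)) = \<bar>(a + s) - (a + t)\<bar>"
      using iso by (auto simp: isometry_between_def algebra_simps)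
    then show "d (f (a + s)) (f (a + t)) = t - s" using st by (simp add: abs_of_nonpos)
  qed
  have "(\<lambda>s. f (a + s)) ` {0..b - a} = f ` {a..b}"
  proof -
    have "(\<lambda>s. a + s) ` {0..b - a} = {a..b}"
    proof (intro equalityI subsetI)
      fix x assume "x \<in> {a..b}"
      then have "x - a \<in> {0..b - a}" "x = a + (x - a)" by simp_all
      then show "x \<in> (\<lambda>s. a + s) ` {0..b - a}" by (rule rev_image_eqI)
    qed (auto simp: algebra_simps)
    then show ?thesis by (metis image_image)
  qed
  then have "S = (\<lambda>s. f (a + s)) ` {0..b - a}" using S by metis
  moreover have "f (a + 0) = x" "f (a + (b - a)) = y" using xy by simp_all
  ultimately show "\<exists>f n. geodesic f n \<and> f 0 = x \<and> f n = y \<and> S = f ` {0..n}"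
    using geo by (intro exI conjI)
next
  assume "\<exists>f n. geodesic f n \<and> f 0 = x \<and> f n = y \<and> S = f ` {0..n}"
  then obtain f n where "geodesic f n" "f 0 = x" "f n = y" "S = f ` {0..n}" by blast
  then show "segment_between M d x y S"
    unfolding segment_between_def
    by (intro exI[of _ 0] exI[of _ n] exI[of _ f])
      (auto simp: geodesic_def isometry_between_def)
qed

lemma geodesic_segment: "geodesic f n \<Longrightarrow> segment_between M d (f 0) (f n) (f ` {0..n})"
  unfolding segment_between_iff by blast

lemma geodesic_exists:
  assumes "x \<in> M" "y \<in> M"
  obtains f where "geodesic f (d x y)" "f 0 = x" "f (d x y) = y"
proof -
  obtain S where "segment_between M d x y S"
    using lambda_tree assms unfolding lambda_tree_def by blast
  then obtain f n where f: "geodesic f n" "f 0 = x" "f n = y"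
    unfolding segment_between_iff by blast
  moreover have "d x y = n" using geodesic_dist_start[OF f(1) geodesic_len[OF f(1)] order_refl] f by simp
  ultimately show ?thesis using that by simp
qed

section \<open>The branch point of two geodesics with a common start\<close>

lemma geodesics_meet:
  assumes f: "geodesic f n" and g: "geodesic g m" and 0: "f 0 = g 0"
    and s: "0 \<le> s" "s \<le> n" and t: "0 \<le> t" "t \<le> m" and eq: "f s = g t"
  shows "s = t"
  using geodesic_dist_start[OF f s] geodesic_dist_start[OF g t] 0 eq by simp

text \<open>By (T3) the intersection of the two images is a segment. The common start is one of its
  endpoints, and \<open>k\<close> is its length; since a common point has the same parameter on both
  geodesics, they agree exactly up to \<open>k\<close>.\<close>

lemma geodesics_split:
  assumes f: "geodesic f n" and g: "geodesic g m" and 0: "f 0 = g 0"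
  obtains k where "0 \<le> k" "k \<le> n" "k \<le> m"
    "\<And>s. 0 \<le> s \<Longrightarrow> s \<le> n \<Longrightarrow> s \<le> m \<Longrightarrow> f s = g s \<longleftrightarrow> s \<le> k"
proof -
  let ?I = "f ` {0..n} \<inter> g ` {0..m}"
  have "is_segment M d ?I"
    using lambda_tree geodesic_segment[OF f] geodesic_segment[OF g] 0
    unfolding lambda_tree_def by (metis (no_types, lifting))
  then obtain h k where h: "geodesic h k" and I: "?I = h ` {0..k}"
    unfolding is_segment_def segment_between_iff by blast
  have n: "0 \<le> n" and m: "0 \<le> m" and k: "0 \<le> k" using f g h by (auto dest: geodesic_len)
  \<comment> \<open>The parametrisation \<open>h\<close> from (T3) may run in either direction, and
    a priori the common start is some \<open>h u\<close>. The endpoints \<open>h 0\<close> and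
    \<open>h k\<close> then lie on \<open>f\<close> at parameters \<open>u\<close> and
    \<open>k - u\<close>, which add up to \<open>k\<close> and also differ by \<open>k\<close>. So
    one of them is \<open>0\<close>, and \<open>h\<close> or its reversal starts at
    \<open>f 0\<close>.\<close>
  have start: "\<exists>h. geodesic h k \<and> ?I = h ` {0..k} \<and> h 0 = f 0"
  proof -
    have "f 0 \<in> ?I" using n m 0 by (intro IntI rev_image_eqI[of 0]) auto
    then obtain u where u: "0 \<le> u" "u \<le> k" "f 0 = h u" using I by auto
    have "h 0 \<in> ?I" "h k \<in> ?I" using k unfolding I by auto
    then obtain i j where i: "0 \<le> i" "i \<le> n" "h 0 = f i" and j: "0 \<le> j" "j \<le> n" "h k = f j"
      by auto
    have hi: "i = u"
      using geodesic_dist_start[OF h u(1,2)] geodesic_dist_start[OF f i(1,2)] i(3) u(3)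
        dist_commute[of "f 0" "f i"] geodesic_in[OF f i(1,2)] geodesic_in[OF f order_refl n] by simp
    have hj: "j = k - u"
      using geodesic_dist[OF h u(1,2) order_refl] geodesic_dist_start[OF f j(1,2)] j(3) u(3) by simp
    have "\<bar>i - j\<bar> = k"
      using geodesic_dist_abs[OF f i(1,2) j(1,2)] geodesic_dist_start[OF h k order_refl] i j by simp
    moreover have "i + j = k" using hi hj by simp
    ultimately have "i + j = \<bar>i - j\<bar>" by simp
    with i j consider "i = 0" | "j = 0" using add_eq_abs_diff by blast
    then show ?thesis
    proof cases
      case 1
      then show ?thesis using h I i by auto
    next
      case 2
      then show ?thesis using geodesic_rev[OF h] I j image_reflect_atLeastAtMost[of h k]
        by (intro exI[of _ "\<lambda>s. h (k - s)"]) simp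
    qed
  qed
  then obtain h where h: "geodesic h k" and I: "?I = h ` {0..k}" and h0: "h 0 = f 0" by blast
  have in_I: "f s = g s \<and> s \<le> n \<and> s \<le> m" if s: "0 \<le> s" "s \<le> k" for s
  proof -
    have "h s \<in> ?I" using s unfolding I by auto
    then obtain i j where i: "0 \<le> i" "i \<le> n" "h s = f i" and j: "0 \<le> j" "j \<le> m" "h s = g j"
      by auto
    have "s = i" using geodesics_meet[OF h f h0 s i(1,2,3)] .
    moreover have "s = j" using geodesics_meet[OF h g _ s j] h0 0 by simp
    ultimately show ?thesis using i j by simp
  qed
  have le: "s \<le> k" if s: "0 \<le> s" "s \<le> n" "s \<le> m" "f s = g s" for s
  proof -
    have "f s \<in> ?I" using s by (intro IntI rev_image_eqI[of s]) auto
    then obtain i where i: "0 \<le> i" "i \<le> k" "f s = h i" unfolding I by auto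
    then have "s = i" using geodesics_meet[OF f h _ s(1,2) i] h0 by simp
    then show ?thesis using i by simp
  qed
  show ?thesis using that[of k] in_I le k by blast
qed

text \<open>Agreement at the far end pushes the branch point out to \<open>n\<close>.\<close>

lemma geodesic_unique:
  assumes "geodesic f n" "geodesic g n" "f 0 = g 0" "f n = g n" "0 \<le> s" "s \<le> n"
  shows "f s = g s"
proof -
  obtain k where k: "0 \<le> k" "k \<le> n"
    "\<And>s. 0 \<le> s \<Longrightarrow> s \<le> n \<Longrightarrow> f s = g s \<longleftrightarrow> s \<le> k"
    using geodesics_split[OF assms(1-3)] by metis
  have "n \<le> k" using k(3)[of n] assms geodesic_len by blast
  then show ?thesis using k(3) assms order_trans by blast
qed

text \<open>Excludes that, on a segment \<open>h\<close> through all three points, both ends lie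
  properly on the same side of the common start: from \<open>u\<close> to \<open>b\<close>,
  \<open>h\<close> is a geodesic with the ends of \<open>q\<close>, hence equals \<open>q\<close>,
  so the end of \<open>p\<close> lies on \<open>q\<close> and must be the only common point.\<close>

lemma geodesics_overlap:
  assumes p: "geodesic p a'" and q: "geodesic q b'" and 0: "p 0 = q 0"
    and meet: "p ` {0..a'} \<inter> q ` {0..b'} = {p 0}"
    and h: "geodesic h l" and u: "0 \<le> u" "u \<le> a" "a \<le> b" "b \<le> l"
    and hu: "h u = p 0" "h a = p a'" "h b = q b'"
  shows "a = u"
proof -
  have ub: "u \<le> b" using u by simp
  have "geodesic (\<lambda>s. h (u + s)) (b - u)" by (rule geodesic_shift[OF h u(1) ub u(4)])
  moreover have "b' = b - u"
    using geodesic_dist[OF h u(1) ub u(4)] geodesic_dist_start[OF q geodesic_len[OF q] order_refl]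
      hu 0 by simp
  ultimately have "h (u + (a - u)) = q (a - u)"
    using geodesic_unique[OF _ q, of "\<lambda>s. h (u + s)" "a - u"] hu 0 u by simp
  then have "p a' \<in> q ` {0..b'}" using \<open>b' = b - u\<close> u hu by auto
  moreover have "p a' \<in> p ` {0..a'}" using geodesic_len[OF p] by auto
  ultimately have "p a' = p 0" using meet by blast
  then have "h u = h a" using hu by simp
  moreover have "d (h u) (h a) = a - u" using u by (intro geodesic_dist[OF h]) auto
  moreover have "h u \<in> M" using u ub by (intro geodesic_in[OF h]) auto
  ultimately show ?thesis using dist_eq_0_iff[of "h u" "h u"] by simp
qed

text \<open>By (T2) the union is a segment, so the claim becomes additivity of lengths along it,
  once the common start is known to lie between the two ends.\<close>

lemma dist_geodesics_meeting_once:
  assumes p: "geodesic p a'" and q: "geodesic q b'" and 0: "p 0 = q 0"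
    and meet: "p ` {0..a'} \<inter> q ` {0..b'} = {p 0}"
  shows "d (p a') (q b') = a' + b'"
proof -
  have "is_segment M d (p ` {0..a'} \<union> q ` {0..b'})"
    using lambda_tree geodesic_segment[OF p] geodesic_segment[OF q] 0 meet
    unfolding lambda_tree_def by (metis (no_types, lifting))
  then obtain h l where h: "geodesic h l" and U: "p ` {0..a'} \<union> q ` {0..b'} = h ` {0..l}"
    unfolding is_segment_def segment_between_iff by blast
  have a': "0 \<le> a'" and b': "0 \<le> b'" using p q by (auto dest: geodesic_len)
  have "p 0 \<in> h ` {0..l}" "p a' \<in> h ` {0..l}" "q b' \<in> h ` {0..l}" 
    using a' b' unfolding U[symmetric] by auto
  then obtain u a b where u: "0 \<le> u" "u \<le> l" "h u = p 0" and a: "0 \<le> a" "a \<le> l" "h a = p a'"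
    and b: "0 \<le> b" "b \<le> l" "h b = q b'" by auto
  have meet': "q ` {0..b'} \<inter> p ` {0..a'} = {q 0}" using meet 0 by auto
  have da: "\<bar>u - a\<bar> = a'" and db: "\<bar>u - b\<bar> = b'" and dab: "d (p a') (q b') = \<bar>a - b\<bar>"
    using geodesic_dist_abs[OF h u(1,2) a(1,2)] geodesic_dist_abs[OF h u(1,2) b(1,2)]
      geodesic_dist_abs[OF h a(1,2) b(1,2)] u(3) a(3) b(3) 0
      geodesic_dist_start[OF p a' order_refl] geodesic_dist_start[OF q b' order_refl] by simp_all
  note hr = geodesic_rev[OF h]
  \<comment> \<open>In the first two orders the common start lies between the ends. In the other
    four both ends lie on one side of it, and \<open>geodesics_overlap\<close> makes the nearer end
    coincide with it; the last two orders are reduced to this by reversing \<open>h\<close>.\<close>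
  consider "u \<le> a" "b \<le> u" | "u \<le> b" "a \<le> u" | "u \<le> a" "a \<le> b" | "u \<le> b" "b \<le> a"
    | "a \<le> u" "b \<le> a" | "b \<le> u" "a \<le> b" by (meson linear)
  then show ?thesis
  proof cases
    case 1
    moreover from 1 have "b \<le> a" by simp
    ultimately have "a' = a - u" "b' = u - b" "d (p a') (q b') = a - b"
      using da db dab by (simp_all add: abs_of_nonneg abs_of_nonpos)
    then show ?thesis by (metis add_diff_eq diff_add_cancel)
  next
    case 2
    moreover from 2 have "a \<le> b" by simp
    ultimately have "a' = u - a" "b' = b - u" "d (p a') (q b') = b - a"
      using da db dab by (simp_all add: abs_of_nonneg abs_of_nonpos)
    then show ?thesis by (metis add.commute add_diff_eq diff_add_cancel)
  next
    case 3
    have "a = u" using geodesics_overlap[OF p q 0 meet h u(1) 3 b(2)] u a b by simp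
    then show ?thesis using da db dab by auto
  next
    case 4
    have "b = u" using geodesics_overlap[OF q p 0[symmetric] meet' h u(1) 4 a(2)] u a b 0 by simp
    then show ?thesis using da db dab by (auto simp: abs_minus_commute)
  next
    case 5
    have "l - a = l - u"
      using geodesics_overlap[OF p q 0 meet hr, of "l - u" "l - a" "l - b"] u a b 5 by simp
    then show ?thesis using da db dab by auto
  next
    case 6
    have "l - b = l - u"
      using geodesics_overlap[OF q p 0[symmetric] meet' hr, of "l - u" "l - b" "l - a"] u a b 0 6
      by simp
    then show ?thesis using da db dab by (auto simp: abs_minus_commute)
  qed
qed

text \<open>Past the branch point the remaining pieces meet only in their start, so the ends are at
  distance \<open>(n - k) + (m - k)\<close>. This expresses \<open>k\<close> by distances.\<close>

lemma geodesics_branch: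
  assumes f: "geodesic f n" and g: "geodesic g m" and 0: "f 0 = g 0"
  obtains k where "0 \<le> k" "k \<le> n" "k \<le> m"
    "\<And>s. 0 \<le> s \<Longrightarrow> s \<le> n \<Longrightarrow> s \<le> m \<Longrightarrow> f s = g s \<longleftrightarrow> s \<le> k"
    "k + k = n + m - d (f n) (g m)"
proof -
  obtain k where k: "0 \<le> k" "k \<le> n" "k \<le> m"
    "\<And>s. 0 \<le> s \<Longrightarrow> s \<le> n \<Longrightarrow> s \<le> m \<Longrightarrow> f s = g s \<longleftrightarrow> s \<le> k"
    using geodesics_split[OF f g 0] by metis
  let ?p = "\<lambda>s. f (k + s)" and ?q = "\<lambda>s. g (k + s)"
  have p: "geodesic ?p (n - k)" and q: "geodesic ?q (m - k)"
    using geodesic_shift[OF f k(1,2)] geodesic_shift[OF g k(1,3)] by auto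
  have fk: "f k = g k" using k by simp
  have "?p ` {0..n - k} \<inter> ?q ` {0..m - k} = {?p 0}"
  proof (intro equalityI subsetI)
    fix z assume "z \<in> ?p ` {0..n - k} \<inter> ?q ` {0..m - k}"
    then obtain s t where "s \<in> {0..n - k}" "t \<in> {0..m - k}" and z: "z = f (k + s)" "z = g (k + t)"
      by blast
    then have s: "0 \<le> s" "k + s \<le> n" and t: "0 \<le> t" "k + t \<le> m" by (simp_all add: algebra_simps)
    have ks: "0 \<le> k + s" "0 \<le> k + t" using k s t by auto
    have "k + s = k + t"
      using geodesics_meet[OF f g 0 ks(1) s(2) ks(2) t(2)] z by simp
    then have "k + s \<le> k" using k(4)[OF ks(1) s(2)] t z by simp
    then have "s = 0" using s by simp
    then show "z \<in> {?p 0}" using z by simp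
  next
    fix z assume "z \<in> {?p 0}"
    then show "z \<in> ?p ` {0..n - k} \<inter> ?q ` {0..m - k}" using k fk by force
  qed
  then have "d (?p (n - k)) (?q (m - k)) = (n - k) + (m - k)"
    using fk by (intro dist_geodesics_meeting_once[OF p q]) auto
  then have "k + k = n + m - d (f n) (g m)" by (simp add: algebra_simps)
  then show ?thesis using that k by blast
qed

section \<open>Points of a segment determined by their distances\<close>

text \<open>Junk outside \<open>0 \<le> a \<le> d x y\<close>, where \<open>THE\<close> has no witness.\<close>

definition pt :: "'z \<Rightarrow> 'z \<Rightarrow> 'l \<Rightarrow> 'z" where
  "pt x y a = (THE z. z \<in> M \<and> d x z = a \<and> d x z + d z y = d x y)"

text \<open>A geodesic from \<open>f 0\<close> to \<open>z\<close> branches from \<open>f\<close> at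
  some \<open>k\<close>. The hypothesis turns the branch formula into
  \<open>k + k = d (f 0) z + d (f 0) z\<close>, so this geodesic never leaves
  \<open>f\<close>.\<close>

lemma geodesic_point_eq:
  assumes f: "geodesic f n" and z: "z \<in> M" and eq: "d (f 0) z + d z (f n) = n"
  shows "z = f (d (f 0) z)"
proof -
  have M: "f 0 \<in> M" "f n \<in> M" using geodesic_in[OF f] geodesic_len[OF f] by auto
  obtain g where g: "geodesic g (d (f 0) z)" "g 0 = f 0" "g (d (f 0) z) = z"
    using geodesic_exists M(1) z by metis
  let ?m = "d (f 0) z"
  obtain k where k: "0 \<le> k" "k \<le> ?m" "k \<le> n"
    "\<And>s. 0 \<le> s \<Longrightarrow> s \<le> ?m \<Longrightarrow> s \<le> n \<Longrightarrow> g s = f s \<longleftrightarrow> s \<le> k"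
    "k + k = ?m + n - d (g ?m) (f n)"
    using geodesics_branch[OF g(1) f g(2)] by metis
  have "k + k = ?m + n - d z (f n)" using k(5) g by simp
  also have "\<dots> = ?m + ?m" using eq by (simp add: algebra_simps)
  finally have "k = ?m" by (simp add: double_eq_iff)
  then have "g ?m = f ?m" using k by auto
  then show ?thesis using g by simp
qed

lemma pt_geodesic:
  assumes f: "geodesic f n" and a: "0 \<le> a" "a \<le> n"
  shows "pt (f 0) (f n) a = f a"
  unfolding pt_def
proof (rule the_equality)
  have n: "d (f 0) (f n) = n" using geodesic_dist_start[OF f geodesic_len[OF f] order_refl] .
  show "f a \<in> M \<and> d (f 0) (f a) = a \<and> d (f 0) (f a) + d (f a) (f n) = d (f 0) (f n)"
    using geodesic_in[OF f a] geodesic_dist_start[OF f a] geodesic_dist[OF f a order_refl] n by simp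
  show "z = f a" if "z \<in> M \<and> d (f 0) z = a \<and> d (f 0) z + d z (f n) = d (f 0) (f n)" for z
    using geodesic_point_eq[OF f] that n by metis
qed

lemma pt_geodesic_between:
  assumes "x \<in> M" "y \<in> M"
  shows "geodesic (pt x y) (d x y)" "pt x y 0 = x" "pt x y (d x y) = y"
proof -
  obtain f where f: "geodesic f (d x y)" "f 0 = x" "f (d x y) = y"
    using geodesic_exists assms by metis
  have eq: "pt x y a = f a" if "0 \<le> a" "a \<le> d x y" for a
    using pt_geodesic[OF f(1) that] f by simp
  have "0 \<le> d x y" using dist_nonneg assms by simp
  then show "pt x y 0 = x" "pt x y (d x y) = y" using eq f by auto
  show "geodesic (pt x y) (d x y)"
    using f(1) unfolding geodesic_def by (auto simp: eq)
qed

lemma pt_eqI: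
  assumes "x \<in> M" "y \<in> M" "z \<in> M" "d x z + d z y = d x y"
  shows "pt x y (d x z) = z"
  using geodesic_point_eq[OF pt_geodesic_between(1)[OF assms(1,2)] assms(3)]
    pt_geodesic_between[OF assms(1,2)] assms(4) by simp

lemma pt_props:
  assumes "x \<in> M" "y \<in> M" "0 \<le> a" "a \<le> d x y"
  shows "pt x y a \<in> M" "d x (pt x y a) = a" "d (pt x y a) y = d x y - a"
  using geodesic_in[OF pt_geodesic_between(1)[OF assms(1,2)] assms(3,4)]
    geodesic_dist_start[OF pt_geodesic_between(1)[OF assms(1,2)] assms(3,4)]
    geodesic_dist[OF pt_geodesic_between(1)[OF assms(1,2)] assms(3,4) order_refl]
    pt_geodesic_between(2,3)[OF assms(1,2)]
  by simp_all

text \<open>Doubling is injective, so any \<open>c\<close> satisfying the equation is the branch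
  parameter. Leaving \<open>c\<close> free allows it to be instantiated with
  \<open>cprod f g\<close>.\<close>

lemma branch_props:
  assumes M: "w \<in> M" "x \<in> M" "y \<in> M" and c: "c + c = d w x + d w y - d x y"
  shows "0 \<le> c" "c \<le> d w x" "c \<le> d w y"
    and "\<And>a. 0 \<le> a \<Longrightarrow> a \<le> d w x \<Longrightarrow> a \<le> d w y \<Longrightarrow> pt w x a = pt w y a \<longleftrightarrow> a \<le> c"
proof -
  note x = pt_geodesic_between[OF M(1,2)] and y = pt_geodesic_between[OF M(1,3)]
  obtain k where k: "0 \<le> k" "k \<le> d w x" "k \<le> d w y"
    "\<And>s. 0 \<le> s \<Longrightarrow> s \<le> d w x \<Longrightarrow> s \<le> d w y \<Longrightarrow> pt w x s = pt w y s \<longleftrightarrow> s \<le> k"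
    "k + k = d w x + d w y - d (pt w x (d w x)) (pt w y (d w y))"
    using geodesics_branch[OF x(1) y(1)] x(2) y(2) by metis
  then have "k + k = c + c" using x(3) y(3) c by simp
  then have "k = c" by (simp add: double_eq_iff)
  then show "0 \<le> c" "c \<le> d w x" "c \<le> d w y"
    "\<And>a. 0 \<le> a \<Longrightarrow> a \<le> d w x \<Longrightarrow> a \<le> d w y \<Longrightarrow> pt w x a = pt w y a \<longleftrightarrow> a \<le> c"
    using k by auto
qed

text \<open>The initial pieces of lengths \<open>a\<close> and \<open>b\<close> agree as long as
  both last and the full geodesics have not branched, so their own branch parameter is
  \<open>min a (min b c)\<close>.\<close>

lemma dist_pt_pt:
  assumes M: "w \<in> M" "x \<in> M" "y \<in> M" and c: "c + c = d w x + d w y - d x y"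
    and a: "0 \<le> a" "a \<le> d w x" and b: "0 \<le> b" "b \<le> d w y"
  shows "d (pt w x a) (pt w y b) = a + b - (min a (min b c) + min a (min b c))"
proof -
  note x = pt_geodesic_between[OF M(1,2)] and y = pt_geodesic_between[OF M(1,3)]
  have xa: "geodesic (pt w x) a" and yb: "geodesic (pt w y) b"
    using geodesic_init x(1) y(1) a b by auto
  obtain k where k: "0 \<le> k" "k \<le> a" "k \<le> b"
    "\<And>s. 0 \<le> s \<Longrightarrow> s \<le> a \<Longrightarrow> s \<le> b \<Longrightarrow> pt w x s = pt w y s \<longleftrightarrow> s \<le> k"
    "k + k = a + b - d (pt w x a) (pt w y b)"
    using geodesics_branch[OF xa yb] x(2) y(2) by metis
  note br = branch_props[OF M c]
  let ?m = "min a (min b c)"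
  have "pt w x k = pt w y k" using k by auto
  then have "k \<le> c" using br(4)[of k] k a b by (meson order_trans)
  then have "k \<le> ?m" using k by simp
  moreover have "?m \<le> k"
  proof -
    have m: "0 \<le> ?m" "?m \<le> a" "?m \<le> b" "?m \<le> c" using a b br by (simp_all add: min_le_iff_disj)
    then have "pt w x ?m = pt w y ?m" using br(4)[of ?m] a b by (meson order_trans)
    then show ?thesis using k(4)[OF m(1,2,3)] by simp
  qed
  ultimately have "k = ?m" by (rule antisym)
  then show ?thesis using k(5) by (simp add: algebra_simps)
qed

section \<open>Subtrees and betweenness\<close>

lemma branch_exists:
  assumes M: "w \<in> M" "x \<in> M" "y \<in> M"
  obtains c where "c + c = d w x + d w y - d x y"
proof -
  note x = pt_geodesic_between[OF M(1,2)] and y = pt_geodesic_between[OF M(1,3)]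
  show ?thesis using geodesics_branch[OF x(1) y(1)] x(2,3) y(2,3) that by metis
qed

text \<open>The points of a segment are those for which the triangle inequality between its ends is
  an equality, so convexity can be tested on distances alone.\<close>

lemma is_subtree_iff:
  "is_subtree M d Y \<longleftrightarrow>
     Y \<subseteq> M \<and> (\<forall>x\<in>Y. \<forall>y\<in>Y. \<forall>z\<in>M. d x z + d z y = d x y \<longrightarrow> z \<in> Y)"
proof
  assume Y: "is_subtree M d Y"
  then have YM: "Y \<subseteq> M" by (simp add: is_subtree_def)
  have "z \<in> Y" if "x \<in> Y" "y \<in> Y" "z \<in> M" "d x z + d z y = d x y" for x y z
  proof -
    have M: "x \<in> M" "y \<in> M" using that YM by auto
    note p = pt_geodesic_between[OF M]
    have "segment_between M d x y (pt x y ` {0..d x y})" using geodesic_segment[OF p(1)] p by simp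
    then have "pt x y ` {0..d x y} \<subseteq> Y" using Y that unfolding is_subtree_def by blast
    moreover have "pt x y (d x z) = z" using pt_eqI M that by simp
    moreover have "d x z \<in> {0..d x y}"
      using dist_nonneg M that by (simp add: that(4)[symmetric])
    ultimately show ?thesis by force
  qed
  then show "Y \<subseteq> M \<and> (\<forall>x\<in>Y. \<forall>y\<in>Y. \<forall>z\<in>M. d x z + d z y = d x y \<longrightarrow> z \<in> Y)" using YM by blast
next
  assume Y: "Y \<subseteq> M \<and> (\<forall>x\<in>Y. \<forall>y\<in>Y. \<forall>z\<in>M. d x z + d z y = d x y \<longrightarrow> z \<in> Y)"
  show "is_subtree M d Y"
    unfolding is_subtree_def
  proof (intro conjI ballI allI impI)
    show "Y \<subseteq> M" using Y by simp
    fix x y S assume xy: "x \<in> Y" "y \<in> Y" and "segment_between M d x y S"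
    then obtain f n where f: "geodesic f n" "f 0 = x" "f n = y" "S = f ` {0..n}"
      unfolding segment_between_iff by blast
    show "S \<subseteq> Y"
    proof
      fix z assume "z \<in> S"
      then obtain s where s: "0 \<le> s" "s \<le> n" "z = f s" using f by auto
      have "d x z + d z y = d x y"
        using geodesic_dist_start[OF f(1) s(1,2)] geodesic_dist[OF f(1) s(1,2) order_refl]
          geodesic_dist_start[OF f(1) geodesic_len[OF f(1)] order_refl] f s by simp
      then show "z \<in> Y" using Y xy s geodesic_in[OF f(1) s(1,2)] by blast
    qed
  qed
qed

text \<open>Let \<open>c\<close> be the length of the common part of the geodesics from
  \<open>x\<close> to \<open>w\<close> and from \<open>x\<close> to \<open>y\<close>. If
  \<open>z\<close> is within \<open>c\<close> of \<open>x\<close>, it lies on the common part, hence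
  between \<open>x\<close> and \<open>w\<close>; otherwise the same argument applies from
  \<open>y\<close>.\<close>

lemma between_via:
  assumes M: "w \<in> M" "x \<in> M" "y \<in> M" "z \<in> M" and z: "d x z + d z y = d x y"
  shows "d w z + d z x = d w x \<or> d w z + d z y = d w y"
proof -
  have *: "d w z + d z x = d w x"
    if M: "x \<in> M" "y \<in> M" and z: "d x z + d z y = d x y"
      and c: "c + c = d x w + d x y - d w y" "d x z \<le> c" for x y c
  proof -
    note br = branch_props[OF M(1) \<open>w \<in> M\<close> M(2) c(1)]
    have "0 \<le> d x z" "d x z \<le> d x w" "d x z \<le> d x y"
      using dist_nonneg M \<open>z \<in> M\<close> br c order_trans by blast+
    then have "pt x w (d x z) = pt x y (d x z)" using br(4) c by simp
    then have "pt x w (d x z) = z" using pt_eqI M \<open>z \<in> M\<close> z by simp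
    then have "d z w = d x w - d x z"
      using pt_props(3)[OF M(1) \<open>w \<in> M\<close> \<open>0 \<le> d x z\<close> \<open>d x z \<le> d x w\<close>] by simp
    then show ?thesis using M \<open>w \<in> M\<close> \<open>z \<in> M\<close> by (simp add: dist_commute algebra_simps)
  qed
  \<comment> \<open>The right-hand side can be halved because it is twice the length of a common
    part.\<close>
  obtain c where c: "c + c = d x w + d x y - d w y" using branch_exists[OF M(2,1,3)] by metis
  show ?thesis
  proof (cases "d x z \<le> c")
    case True
    then show ?thesis using *[OF M(2,3) z c] by simp
  next
    case False
    \<comment> \<open>The branch parameter as seen from \<open>y\<close>.\<close>
    let ?c = "d x y - c"
    have "?c + ?c = d x y + d x y - (c + c)" by (simp add: algebra_simps)
    also have "\<dots> = d y w + d y x - d w x"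
      unfolding c using M by (simp add: dist_commute algebra_simps)
    finally have c': "?c + ?c = d y w + d y x - d w x" .
    have "d y z + c \<le> d x y" using False M z by (simp add: dist_commute z[symmetric])
    then have "d y z \<le> ?c" by (simp add: algebra_simps)
    moreover have "d y z + d z x = d y x" using z M by (simp add: dist_commute add.commute)
    ultimately show ?thesis using *[OF M(3,2) _ c'] by simp
  qed
qed

end


section \<open>The empty word and cancellation of a word with its inverse\<close>

lemma reduced_wempty: "reduced_word (wempty :: ('l::discretely_ordered_ab_group_add, 'x) lword)"
proof -
  have False if "1 \<le> b" "b < 0" for b :: 'l
    using one_pos that by (meson less_le_trans less_asym)
  then show ?thesis by (auto simp: reduced_word_def is_word_def wempty_def extensional_def)
qed

lemma is_word_wempty: "is_word wempty"
  using reduced_wempty unfolding reduced_word_def by (rule conjunct1)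

lemma winv_wempty: "winv wempty = (wempty :: ('l::discretely_ordered_ab_group_add, 'x) lword)"
proof (rule word_eqI)
  fix a :: 'l assume "1 \<le> a" "a \<le> wlen (winv wempty)"
  then have "(1::'l) \<le> 0" by (simp add: wempty_def)
  then show "wat (winv wempty) a = wat wempty a" using one_pos by (meson not_le)
qed (simp_all add: is_word_wempty is_word_winv)

lemma wconcat_wempty:
  assumes "is_word u"
  shows "wconcat u wempty = u"
proof (rule word_eqI)
  have "0 \<le> wlen u" using assms by (simp add: is_word_def)
  then show "is_word (wconcat u wempty)" by (simp add: is_word_def wconcat_def wempty_def)
qed (use assms in \<open>auto simp: wconcat_def wempty_def\<close>)

text \<open>The common initial segment of \<open>g\<close> with itself is all of \<open>g\<close>,
  and both remainders are empty. Hence \<open>winv g\<close> acts as the inverse of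
  \<open>g\<close>.\<close>

lemma star_winv_self:
  assumes "reduced_word g"
  shows "star (winv g) g = wempty"
proof (rule star_eqI)
  have g: "is_word g" using assms by (simp add: reduced_word_def)
  then have "is_circ g g wempty"
    using assms by (simp add: is_circ_def wconcat_wempty reduced_wempty)
  then show "com_split (winv (winv g)) g g wempty wempty"
    using g by (simp add: com_split_def winv_winv)
  show "is_circ wempty (winv wempty) wempty"
    by (simp add: is_circ_def winv_wempty wconcat_wempty reduced_wempty is_word_wempty)
qed

lemma reduced_word_CDR: "v \<in> CDR X \<Longrightarrow> reduced_word v"
  by (auto simp: CDR_def R_words_def reduced_wempty)

section \<open>The action on \<open>Z\<close> and the distances between orbit points\<close>

locale word_tree_action = lambda_tree_space Z d'
  for Z :: "'z set" and d' :: "'z \<Rightarrow> 'z \<Rightarrow> 'l::discretely_ordered_ab_group_add" +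
  fixes X :: "'x set" and G :: "('l, 'x) lword set"
    and \<phi> :: "('l, 'x) lword \<Rightarrow> 'z \<Rightarrow> 'z" and w :: 'z
  assumes subgroup: "CDR_subgroup X G"
    and action: "isometric_action (word_group G) Z d' \<phi>"
    and base: "w \<in> Z"
    and len: "g \<in> G \<Longrightarrow> d' w (\<phi> g w) = wlen g"
begin

lemma word: "g \<in> G \<Longrightarrow> reduced_word g" "g \<in> G \<Longrightarrow> is_word g" "g \<in> G \<Longrightarrow> 0 \<le> wlen g"
  using subgroup reduced_word_CDR[of g X]
  by (auto simp: CDR_subgroup_def reduced_word_def is_word_def)

lemma wempty_in: "wempty \<in> G"
  and winv_in: "g \<in> G \<Longrightarrow> winv g \<in> G"
  and star_in: "f \<in> G \<Longrightarrow> g \<in> G \<Longrightarrow> star f g \<in> G"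
  using subgroup by (auto simp: CDR_subgroup_def)

lemma com_defined_G:
  assumes "f \<in> G" "g \<in> G"
  shows "com_defined f g"
proof -
  have "com_defined (winv (winv f)) g"
    using subgroup assms winv_in by (simp add: CDR_subgroup_def)
  then show ?thesis using word assms by (simp add: winv_winv)
qed

lemma act_in: "g \<in> G \<Longrightarrow> z \<in> Z \<Longrightarrow> \<phi> g z \<in> Z"
  and act_dist: "g \<in> G \<Longrightarrow> x \<in> Z \<Longrightarrow> y \<in> Z \<Longrightarrow> d' (\<phi> g x) (\<phi> g y) = d' x y"
  using action by (auto simp: isometric_action_def isometry_between_def word_group_def)

lemma act_star: "f \<in> G \<Longrightarrow> g \<in> G \<Longrightarrow> z \<in> Z \<Longrightarrow> \<phi> (star f g) z = \<phi> f (\<phi> g z)"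
  using action group_action.composition_rule[of "word_group G" Z \<phi> z f g]
  by (simp add: isometric_action_def word_group_def)

lemma act_wempty: "z \<in> Z \<Longrightarrow> \<phi> wempty z = z"
  using action group_action.id_eq_one[of "word_group G" Z \<phi>, symmetric]
  by (simp add: isometric_action_def word_group_def)

lemma act_winv:
  assumes "g \<in> G" "z \<in> Z"
  shows "\<phi> (winv g) (\<phi> g z) = z" "\<phi> g (\<phi> (winv g) z) = z"
proof -
  have *: "\<phi> (winv g) (\<phi> g z) = z" if "g \<in> G" for g
    using act_star[OF winv_in[OF that] that assms(2)] star_winv_self[OF word(1)[OF that]]
      act_wempty[OF assms(2)] by simp
  show "\<phi> (winv g) (\<phi> g z) = z" "\<phi> g (\<phi> (winv g) z) = z"
    using *[OF assms(1)] *[OF winv_in[OF assms(1)]] assms(1) by (simp_all add: winv_winv word)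
qed

lemma orbit_in: "g \<in> G \<Longrightarrow> \<phi> g w \<in> Z"
  using act_in base by simp

text \<open>Translation by \<open>winv f\<close> carries \<open>\<phi> f w\<close> to
  \<open>w\<close>, where the length hypothesis applies.\<close>

lemma dist_orbit:
  assumes "f \<in> G" "g \<in> G"
  shows "d' (\<phi> f w) (\<phi> g w) = wlen (star (winv f) g)"
proof -
  have "wlen (star (winv f) g) = d' w (\<phi> (winv f) (\<phi> g w))"
    using assms len[symmetric] act_star star_in winv_in base by simp
  also have "\<dots> = d' (\<phi> f w) (\<phi> f (\<phi> (winv f) (\<phi> g w)))"
    using assms act_dist act_in winv_in base by simp
  finally show ?thesis using act_winv assms orbit_in by simp
qed

text \<open>Links words to the tree: with lengths read as distances, \<open>cprod_double\<close>
  becomes the branch equation at \<open>w\<close>, so \<open>branch_props\<close> and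
  \<open>dist_pt_pt\<close> apply with \<open>c = cprod f g\<close>.\<close>

lemma cprod_branch:
  assumes "f \<in> G" "g \<in> G"
  shows "cprod f g + cprod f g = d' w (\<phi> f w) + d' w (\<phi> g w) - d' (\<phi> f w) (\<phi> g w)"
  using cprod_double[OF com_defined_G[OF assms]] dist_orbit assms len by simp

section \<open>Points on the segments from \<open>w\<close> to its orbit, the intended images of the
  pairs\<close>

definition arc :: "'l \<Rightarrow> ('l, 'x) lword \<Rightarrow> 'z" where
  "arc a g = pt w (\<phi> g w) a"

lemma arc_props:
  assumes "(a, g) \<in> SG G"
  shows "arc a g \<in> Z" "d' w (arc a g) = a" "d' (arc a g) (\<phi> g w) = wlen g - a"
  using pt_props[OF base orbit_in, of g a] assms len[of g] unfolding arc_def SG_def by auto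

text \<open>Identifies a point of \<open>Z\<close> from its distances to \<open>w\<close> and
  \<open>\<phi> g w\<close>; the action formula, uniqueness and the image all rest on this.\<close>

lemma arc_eqI:
  assumes "g \<in> G" "z \<in> Z" "d' w z + d' z (\<phi> g w) = wlen g"
  shows "arc (d' w z) g = z" "(d' w z, g) \<in> SG G"
proof -
  show "arc (d' w z) g = z"
    unfolding arc_def using assms len base orbit_in by (intro pt_eqI) auto
  have "0 \<le> d' w z" "0 \<le> d' z (\<phi> g w)" using assms base orbit_in dist_nonneg by auto
  then show "(d' w z, g) \<in> SG G" using assms by (simp add: SG_def assms(3)[symmetric])
qed

lemma arc_ends:
  assumes "g \<in> G"
  shows "arc 0 g = w" "arc (wlen g) g = \<phi> g w" "(0, g) \<in> SG G" "(wlen g, g) \<in> SG G"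
  using arc_eqI[of g w] arc_eqI[of g "\<phi> g w"] assms len base orbit_in
    dist_eq_0_iff[of w w] dist_eq_0_iff[of "\<phi> g w" "\<phi> g w"] by simp_all

lemma dist_arc:
  assumes "(a, f) \<in> SG G" "(b, g) \<in> SG G"
  shows "d' (arc a f) (arc b g) =
    (let m = min a (min b (cprod f g)) in a + b - (m + m))"
  using dist_pt_pt[OF base orbit_in orbit_in cprod_branch, of f g a b] assms len
  by (simp add: SG_def arc_def Let_def)

text \<open>For equal parameters this is branching at \<open>cprod f g\<close>. For different ones
  the pairs are inequivalent by definition, and their arc points differ in distance from
  \<open>w\<close>.\<close>

lemma SG_rel_iff:
  assumes "(a, f) \<in> SG G" "(b, g) \<in> SG G"
  shows "((a, f), (b, g)) \<in> SG_rel G \<longleftrightarrow> arc a f = arc b g"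
proof (cases "a = b")
  case True
  then show ?thesis
    using branch_props(4)[OF base orbit_in orbit_in cprod_branch, of f g a] assms len
    by (simp add: SG_rel_def SG_def arc_def)
next
  case False
  then have "arc a f \<noteq> arc b g" using arc_props(2) assms by metis
  with False show ?thesis by (simp add: SG_rel_def)
qed

text \<open>As the kernel of \<open>arc\<close> on \<open>SG G\<close>, the relation is visibly an
  equivalence, with the fibres of \<open>arc\<close> as classes.\<close>

lemma SG_rel_kernel: "SG_rel G = {(p, q). p \<in> SG G \<and> q \<in> SG G \<and> case_prod arc p = case_prod arc q}"
proof (rule Set.set_eqI)
  fix r :: "('l \<times> ('l, 'x) lword) \<times> ('l \<times> ('l, 'x) lword)"
  obtain a f b g where r: "r = ((a, f), (b, g))" by (metis surj_pair)
  have "(a, f) \<in> SG G \<and> (b, g) \<in> SG G" if "r \<in> SG_rel G"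
    using that r by (auto simp: SG_rel_def)
  then show "r \<in> SG_rel G \<longleftrightarrow>
      r \<in> {(p, q). p \<in> SG G \<and> q \<in> SG G \<and> case_prod arc p = case_prod arc q}"
    using SG_rel_iff[of a f b g] r by auto
qed

section \<open>The induced map on classes, its distances and its equivariance\<close>

lemma gclass_mem_iff:
  assumes "(a, g) \<in> SG G"
  shows "(b, h) \<in> gclass G a g \<longleftrightarrow> (b, h) \<in> SG G \<and> arc b h = arc a g"
  using assms by (auto simp: gclass_def SG_rel_kernel)

lemma gclass_in: "(a, g) \<in> SG G \<Longrightarrow> gclass G a g \<in> Gamma G"
  by (simp add: gclass_def Gamma_def quotientI)

lemma Gamma_cases:
  assumes "P \<in> Gamma G"
  obtains a g where "P = gclass G a g" "(a, g) \<in> SG G"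
  using assms by (auto simp: Gamma_def gclass_def elim!: quotientE)

definition mu :: "('l, 'x) gpoint \<Rightarrow> 'z" where
  "mu = (\<lambda>P\<in>Gamma G. the_elem ((\<lambda>(a, g). arc a g) ` P))"

lemma mu_gclass:
  assumes "(a, g) \<in> SG G"
  shows "mu (gclass G a g) = arc a g"
proof -
  have "the_elem ((\<lambda>(a, g). arc a g) ` gclass G a g) = (\<lambda>(a, g). arc a g) (a, g)"
  proof (rule the_elem_image_unique)
    show "gclass G a g \<noteq> {}" using gclass_mem_iff[OF assms] assms by blast
    show "(\<lambda>(a, g). arc a g) p = (\<lambda>(a, g). arc a g) (a, g)" if "p \<in> gclass G a g" for p
      using that gclass_mem_iff[OF assms] by (cases p) simp
  qed
  then show ?thesis using gclass_in[OF assms] by (simp add: mu_def)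
qed

text \<open>Lets equality in \<open>Gamma G\<close> be tested in \<open>Z\<close>, which is how the
  action formula is seen to be independent of representatives.\<close>

lemma mu_inj:
  assumes "P \<in> Gamma G" "Q \<in> Gamma G" "mu P = mu Q"
  shows "P = Q"
proof -
  obtain a g where P: "P = gclass G a g" "(a, g) \<in> SG G" using assms(1) by (rule Gamma_cases)
  obtain b h where Q: "Q = gclass G b h" "(b, h) \<in> SG G" using assms(2) by (rule Gamma_cases)
  have "arc a g = arc b h" using P Q assms mu_gclass by simp
  then show ?thesis using P Q by (auto simp: gclass_mem_iff)
qed

text \<open>By \<open>dist_arc\<close> the expression under \<open>the_elem\<close> is, for every
  choice of representatives, the same distance in \<open>Z\<close>.\<close>

lemma gdist_mu:
  assumes "P \<in> Gamma G" "Q \<in> Gamma G"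
  shows "gdist P Q = d' (mu P) (mu Q)"
proof -
  let ?f = "\<lambda>((a, f), (b, g)). let m = min a (min b (cprod f g)) in a + b - (m + m)"
  obtain a g where P: "P = gclass G a g" "(a, g) \<in> SG G" using assms(1) by (rule Gamma_cases)
  obtain b h where Q: "Q = gclass G b h" "(b, h) \<in> SG G" using assms(2) by (rule Gamma_cases)
  have f: "?f ((a', g'), (b', h')) = d' (arc a g) (arc b h)"
    if "(a', g') \<in> P" "(b', h') \<in> Q" for a' g' b' h'
    using that P Q dist_arc[of a' g' b' h'] by (simp add: gclass_mem_iff)
  have mem: "(a, g) \<in> P" "(b, h) \<in> Q" using P Q by (auto simp: gclass_mem_iff)
  have "the_elem (?f ` (P \<times> Q)) = ?f ((a, g), (b, h))"
  proof (rule the_elem_image_unique)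
    show "P \<times> Q \<noteq> {}" using mem by blast
    show "?f y = ?f ((a, g), (b, h))" if "y \<in> P \<times> Q" for y
    proof -
      obtain a' g' b' h' where "y = ((a', g'), (b', h'))" by (metis surj_pair)
      then show ?thesis using that f mem by simp
    qed
  qed
  also have "\<dots> = d' (mu P) (mu Q)" using f[OF mem] P Q mu_gclass by simp
  finally show ?thesis by (simp add: gdist_def)
qed

text \<open>The moved point has distance \<open>a\<close> from \<open>\<phi> f w\<close>, and its
  distance from \<open>w\<close> is that of \<open>arc a g\<close> from
  \<open>\<phi> (winv f) w\<close>, which \<open>dist_arc\<close> computes. These distances place it
  on the segment from \<open>w\<close> to \<open>\<phi> f w\<close> if \<open>a \<le> c\<close>, and
  otherwise on the one to \<open>\<phi> (star f g) w\<close>.\<close>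

lemma move_arc:
  assumes f: "f \<in> G" and ag: "(a, g) \<in> SG G"
  defines "c \<equiv> cprod (winv f) g"
  defines "Q \<equiv> if a \<le> c then gclass G (wlen f - a) f
              else gclass G (wlen f + a - (c + c)) (star f g)"
  shows "Q \<in> Gamma G \<and> mu Q = \<phi> f (arc a g)"
proof -
  have g: "g \<in> G" and a: "0 \<le> a" "a \<le> wlen g" using ag by (auto simp: SG_def)
  note f' = winv_in[OF f]
  let ?z = "arc a g"
  note z = arc_props[OF ag]
  have fz: "\<phi> f ?z \<in> Z" using act_in f z by simp
  have "d' (\<phi> f w) (\<phi> f ?z) = a" using z f act_dist base by simp
  moreover have "\<phi> f (\<phi> (winv f) w) = w" using act_winv f base by simp
  then have "d' w (\<phi> f ?z) = d' (\<phi> (winv f) w) ?z"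
    using act_dist[OF f orbit_in[OF f'] z(1)] by simp
  moreover have "d' (\<phi> (winv f) w) ?z =
      (let m = min (wlen f) (min a c) in wlen f + a - (m + m))"
    using dist_arc[OF arc_ends(4)[OF f'] ag] arc_ends(2)[OF f'] by (simp add: c_def)
  \<comment> \<open>A common part is no longer than \<open>f\<close>, so \<open>wlen f\<close> drops
    out of the minimum.\<close>
  moreover have "c \<le> wlen f"
    using branch_props(2)[OF base orbit_in[OF f'] orbit_in[OF g] cprod_branch[OF f' g]]
      len[OF f'] by (simp add: c_def)
  then have "min (wlen f) (min a c) = min a c" by (intro min.absorb2) (rule min.coboundedI2)
  ultimately have d: "d' (\<phi> f w) (\<phi> f ?z) = a"
    "d' w (\<phi> f ?z) = wlen f + a - (min a c + min a c)" by (simp_all add: Let_def)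
  show ?thesis
  proof (cases "a \<le> c")
    case True
    then have "d' w (\<phi> f ?z) = wlen f - a" using d by (simp add: algebra_simps)
    moreover from this have "d' w (\<phi> f ?z) + d' (\<phi> f ?z) (\<phi> f w) = wlen f"
      using d fz f orbit_in by (simp add: dist_commute)
    ultimately show ?thesis
      using arc_eqI[OF f fz] True mu_gclass gclass_in by (simp add: Q_def)
  next
    case False
    then have w: "d' w (\<phi> f ?z) = wlen f + a - (c + c)" using d by simp
    \<comment> \<open>To place the moved point between \<open>w\<close> and
      \<open>\<phi> (star f g) w\<close>, its two distances are shown to add up to the length of
      \<open>star f g\<close>.\<close>
    have "wlen (star f g) = d' (\<phi> (winv f) w) (\<phi> g w)"
      using dist_orbit[OF f' g] by (simp add: winv_winv word f)
    also have "\<dots> = wlen f + wlen g - (c + c)"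
      using cprod_branch[OF f' g] len[OF f'] len[OF g] by (simp add: c_def algebra_simps)
    also have "\<dots> = d' w (\<phi> f ?z) + d' (\<phi> f ?z) (\<phi> (star f g) w)"
    proof -
      have "d' (\<phi> f ?z) (\<phi> (star f g) w) = wlen g - a"
        using act_dist[OF f z(1) orbit_in[OF g]] z(3) act_star[OF f g base] by simp
      then show ?thesis by (simp add: w algebra_simps)
    qed
    finally show ?thesis
      using arc_eqI[OF star_in[OF f g] fz] False w mu_gclass gclass_in by (simp add: Q_def)
  qed
qed

text \<open>Every representative of \<open>P\<close> yields a class with the same image
  \<open>\<phi> f (mu P)\<close>, so by \<open>mu_inj\<close> all these classes coincide.\<close>

lemma gact_mu:
  assumes f: "f \<in> G" and P: "P \<in> Gamma G"
  shows "gact G f P \<in> Gamma G \<and> mu (gact G f P) = \<phi> f (mu P)"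
proof -
  let ?m = "\<lambda>(a, g). let c = cprod (winv f) g in
     if a \<le> c then gclass G (wlen f - a) f
     else gclass G (wlen f + a - (c + c)) (star f g)"
  obtain a g where ag: "P = gclass G a g" "(a, g) \<in> SG G" using P by (rule Gamma_cases)
  have m: "?m p \<in> Gamma G" "mu (?m p) = \<phi> f (arc a g)" if "p \<in> P" for p
  proof -
    obtain b h where p: "p = (b, h)" by (cases p)
    then have bh: "(b, h) \<in> SG G" "arc b h = arc a g"
      using that ag gclass_mem_iff by auto
    show "?m p \<in> Gamma G" "mu (?m p) = \<phi> f (arc a g)"
      using move_arc[OF f bh(1)] bh(2) p by (simp_all add: Let_def)
  qed
  have mem: "(a, g) \<in> P" using ag gclass_mem_iff by simp
  have "the_elem (?m ` P) = ?m (a, g)"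
  proof (rule the_elem_image_unique)
    show "P \<noteq> {}" using mem by blast
    show "?m p = ?m (a, g)" if "p \<in> P" for p
      using mu_inj[OF m(1)[OF that] m(1)[OF mem] trans[OF m(2)[OF that] m(2)[OF mem, symmetric]]] .
  qed
  then have "gact G f P = ?m (a, g)" by (simp only: gact_def)
  moreover have "mu P = arc a g" using ag mu_gclass by simp
  ultimately show ?thesis using m[OF mem] by (simp only:)
qed

section \<open>Existence, uniqueness and image of the equivariant isometry\<close>

lemma mu_based_equivariant_isometry: "based_equivariant_isometry G Z d' \<phi> w mu"
  unfolding based_equivariant_isometry_def isometry_between_def
proof (intro conjI ballI funcsetI)
  show "mu \<in> extensional (Gamma G)" by (simp add: mu_def)
  show "mu P \<in> Z" if "P \<in> Gamma G" for P
    using that mu_gclass arc_props Gamma_cases by metis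
  show "d' (mu P) (mu Q) = gdist P Q" if "P \<in> Gamma G" "Q \<in> Gamma G" for P Q
    using that gdist_mu by simp
  show "mu (gact G g P) = \<phi> g (mu P)" if "g \<in> G" "P \<in> Gamma G" for g P
    using that gact_mu by simp
  show "mu (gbase G) = w"
    using mu_gclass arc_ends[OF wempty_in] by (simp add: gbase_def)
qed

text \<open>Equivariance fixes the value at the translate \<open>?E\<close> of the base point to be
  \<open>\<phi> g w\<close>. Being isometric, \<open>\<nu>\<close> then gives \<open>\<nu> P\<close>
  the same distances to \<open>w\<close> and \<open>\<phi> g w\<close> as \<open>mu P\<close>, and
  these determine a point between the two.\<close>

lemma based_equivariant_isometry_unique:
  assumes "based_equivariant_isometry G Z d' \<phi> w \<nu>"
  shows "\<nu> = mu"
proof (rule extensionalityI)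
  note \<nu> = assms[unfolded based_equivariant_isometry_def isometry_between_def]
  show "\<nu> \<in> extensional (Gamma G)" using \<nu> by simp
  show "mu \<in> extensional (Gamma G)" by (simp add: mu_def)
  fix P assume P: "P \<in> Gamma G"
  then obtain a g where ag: "P = gclass G a g" "(a, g) \<in> SG G" by (rule Gamma_cases)
  then have g: "g \<in> G" by (simp add: SG_def)
  have b: "gbase G \<in> Gamma G" "mu (gbase G) = w" "\<nu> (gbase G) = w"
    using gclass_in arc_ends(3)[OF wempty_in] mu_based_equivariant_isometry \<nu>
    by (auto simp: gbase_def based_equivariant_isometry_def)
  let ?E = "gact G g (gbase G)"
  have E: "?E \<in> Gamma G" "mu ?E = \<phi> g w" "\<nu> ?E = \<phi> g w"
    using gact_mu[OF g b(1)] b \<nu> g by auto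
  have "\<nu> P \<in> Z" using \<nu> P by auto
  moreover have w: "d' w (\<nu> P) = d' w (mu P)"
    using \<nu> gdist_mu[OF b(1) P] b P by metis
  moreover have "d' (\<nu> P) (\<phi> g w) = d' (mu P) (\<phi> g w)"
    using \<nu> gdist_mu[OF P E(1)] E P by metis
  moreover have "mu P = arc a g" using ag mu_gclass by simp
  ultimately have "arc (d' w (\<nu> P)) g = \<nu> P"
    using arc_props[OF ag(2)] by (intro arc_eqI[OF g]) simp_all
  then show "\<nu> P = mu P" using w \<open>mu P = arc a g\<close> arc_props[OF ag(2)] by simp
qed

text \<open>The set on the right is the union of the segments from \<open>w\<close> to its orbit
  points, written with distances to match \<open>is_subtree_iff\<close>.\<close>

lemma mu_image: "mu ` Gamma G = {z \<in> Z. \<exists>g\<in>G. d' w z + d' z (\<phi> g w) = d' w (\<phi> g w)}"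
proof (intro equalityI subsetI)
  fix z assume "z \<in> mu ` Gamma G"
  then obtain P where P: "P \<in> Gamma G" "z = mu P" by blast
  obtain a g where "P = gclass G a g" "(a, g) \<in> SG G" using P(1) by (rule Gamma_cases)
  with P have "(a, g) \<in> SG G" "z = arc a g" using mu_gclass by simp_all
  then show "z \<in> {z \<in> Z. \<exists>g\<in>G. d' w z + d' z (\<phi> g w) = d' w (\<phi> g w)}"
    using arc_props[of a g] len[of g] by (auto simp: SG_def intro!: bexI[of _ g])
next
  fix z assume "z \<in> {z \<in> Z. \<exists>g\<in>G. d' w z + d' z (\<phi> g w) = d' w (\<phi> g w)}"
  then obtain g where "z \<in> Z" "g \<in> G" "d' w z + d' z (\<phi> g w) = wlen g" using len by auto
  note z = arc_eqI[OF this(2,1,3)]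
  then have "z = mu (gclass G (d' w z) g)" using mu_gclass by simp
  then show "z \<in> mu ` Gamma G" using gclass_in z by blast
qed

lemma mu_image_spanned:
  "mu ` Gamma G = spanned_subtree Z d' (orbit (word_group G) \<phi> w)"
  unfolding spanned_subtree_def
proof (rule hull_unique[symmetric])
  have orbit: "orbit (word_group G) \<phi> w = (\<lambda>g. \<phi> g w) ` G"
    by (auto simp: orbit_def word_group_def)
  show "orbit (word_group G) \<phi> w \<subseteq> mu ` Gamma G"
  proof
    fix z assume "z \<in> orbit (word_group G) \<phi> w"
    then obtain g where g: "g \<in> G" "z = \<phi> g w" unfolding orbit by blast
    then have "z \<in> Z" "d' z z = 0" using orbit_in dist_eq_0_iff by simp_all
    then show "z \<in> mu ` Gamma G" using g unfolding mu_image by (auto intro!: bexI[of _ g])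
  qed
  show "is_subtree Z d' (mu ` Gamma G)"
    unfolding is_subtree_iff
  proof (intro conjI ballI impI)
    show "mu ` Gamma G \<subseteq> Z" unfolding mu_image by auto
    fix x y z assume xy: "x \<in> mu ` Gamma G" "y \<in> mu ` Gamma G"
      and z: "z \<in> Z" "d' x z + d' z y = d' x y"
    \<comment> \<open>A point between \<open>w\<close> and a point of the segment to
      \<open>\<phi> g w\<close> is itself on that segment, by two triangle inequalities. With
      \<open>between_via\<close> this gives convexity.\<close>
    have *: "z \<in> mu ` Gamma G" if x: "x \<in> mu ` Gamma G" and wz: "d' w z + d' z x = d' w x" for x
    proof -
      obtain g where g: "g \<in> G" "x \<in> Z" "d' w x + d' x (\<phi> g w) = d' w (\<phi> g w)"
        using x unfolding mu_image by auto
      have "d' z (\<phi> g w) \<le> d' z x + d' x (\<phi> g w)" using dist_triangle g z orbit_in by simp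
      then have "d' w z + d' z (\<phi> g w) \<le> d' w z + d' z x + d' x (\<phi> g w)"
        by (simp add: add.assoc)
      then have "d' w z + d' z (\<phi> g w) \<le> d' w (\<phi> g w)" using wz g by simp
      moreover have "d' w (\<phi> g w) \<le> d' w z + d' z (\<phi> g w)"
        using dist_triangle g z orbit_in base by simp
      ultimately have "d' w z + d' z (\<phi> g w) = d' w (\<phi> g w)" by simp
      then show ?thesis using g z unfolding mu_image by auto
    qed
    have "x \<in> Z" "y \<in> Z" using xy unfolding mu_image by auto
    then show "z \<in> mu ` Gamma G" using between_via[OF base _ _ z] * xy by blast
  qed
  fix Y assume Y: "orbit (word_group G) \<phi> w \<subseteq> Y" "is_subtree Z d' Y"
  \<comment> \<open>The base point is the orbit point of the empty word, so both ends of each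
    segment lie in \<open>Y\<close>.\<close>
  have "w \<in> Y" using Y(1) wempty_in act_wempty[OF base] unfolding orbit by force
  then show "mu ` Gamma G \<subseteq> Y"
    using Y unfolding mu_image is_subtree_iff orbit by blast
qed

end

theorem proposition3:
  fixes X :: "'x set"
    and G :: "('l::discretely_ordered_ab_group_add, 'x) lword set"
    and Z :: "'z set"
    and d' :: "'z \<Rightarrow> 'z \<Rightarrow> 'l"
    and \<phi> :: "('l, 'x) lword \<Rightarrow> 'z \<Rightarrow> 'z"
    and w :: 'z
  assumes "CDR_subgroup X G"
    and "lambda_tree Z d'"
    and "isometric_action (word_group G) Z d' \<phi>"
    and "free_action (word_group G) Z \<phi>"
    and "w \<in> Z"
    and "\<And>g. g \<in> G \<Longrightarrow> d' w (\<phi> g w) = wlen g"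
  shows "\<exists>\<mu>. based_equivariant_isometry G Z d' \<phi> w \<mu> \<and>
           (\<forall>\<nu>. based_equivariant_isometry G Z d' \<phi> w \<nu> \<longrightarrow> \<nu> = \<mu>) \<and>
           \<mu> ` Gamma G = spanned_subtree Z d' (orbit (word_group G) \<phi> w)"
proof -
  interpret word_tree_action Z d' X G \<phi> w
    using assms by unfold_locales auto
  show ?thesis
    using mu_based_equivariant_isometry based_equivariant_isometry_unique mu_image_spanned
    by blast
qed

end
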